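(* Let $\mathsf{A}$ be an abelian category, $\mathsf{W}$ a special precovering subcategory of $\mathsf{A}$, and $\mathrm{G}$ a covariant additive functor from $\mathsf{A}$ to the category $\mathsf{Ab}$ of abelian groups which is left $\operatorname{Hom}_{\mathsf{A}}(\mathsf{W},-)$-exact. Then the following statements are equivalent: (i) The $\mathsf{W}$-stable functor $\underline{\mathrm{G}}^{\mathsf{W}}$ is left $\operatorname{Hom}_{\mathsf{A}}(\mathsf{W},-)$-exact. (ii) $\underline{\mathrm{G}}^{\mathsf{W}}(\mathsf{\Omega}^{\mathsf{W}}_iN)=0$ for each object $N$ in $\mathsf{A}$ and all $i\ge1$. (iii) $\underline{\mathrm{G}}^{\mathsf{W}}(\mathsf{\Omega}^{\mathsf{W}}N)=0$ for each object $N$ in $\mathsf{A}$.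
   Context: "Subcategory" means a full additive subcategory closed under isomorphisms; Ext is Yoneda Ext. $\mathsf{W}^{\perp}=\{N\mid\operatorname{Ext}^1_{\mathsf{A}}(W,N)=0\ \forall W\in\mathsf{W}\}$. $\mathsf{W}$ is special precovering if every object $M$ admits an exact sequence $0\to K\to W\to M\to0$ with $W\in\mathsf{W}$, $K\in\mathsf{W}^{\perp}$ (a special $\mathsf{W}$-precover). A sequence is $\operatorname{Hom}_{\mathsf{A}}(\mathsf{W},-)$-exact if it stays exact under $\operatorname{Hom}_{\mathsf{A}}(W,-)$ for all $W\in\mathsf{W}$. A proper $\mathsf{W}$-resolution of $N$ is a complex $P=(\cdots\to P_1\to P_0\to0)$ of objects in $\mathsf{W}$ with a $\operatorname{Hom}_{\mathsf{A}}(\mathsf{W},-)$-exact exact sequence $\cdots\to P_1\to P_0\xrightarrow{f}N\to0$; it is special if $\operatorname{Coker}(P_{i+1}\to P_i)\in\mathsf{W}^{\perp}$ for $i\ge1$. $\mathsf{\Omega}^{\mathsf{W}}_iN$ is $\operatorname{Coker}(P_{i+1}\to P_i)$ for some special proper $\mathsf{W}$-resolution $P$ of $N$ and $\mathsf{\Omega}^{\mathsf{W}}N=\mathsf{\Omega}^{\mathsf{W}}_1N$. Put $\mathrm{L}_0^{\mathsf{W}}\mathrm{G}(N)=\operatorname{Coker}(\mathrm{G}(P_1)\to\mathrm{G}(P_0))$. $\mathrm{G}(f)$ induces a natural transformation $\varrho\colon\mathrm{L}_0^{\mathsf{W}}\mathrm{G}\to\mathrm{G}$, and $\underline{\mathrm{G}}^{\mathsf{W}}=\operatorname{Coker}\varrho$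 is the $\mathsf{W}$-stable functor of $\mathrm{G}$ (independent of choices). A covariant additive functor $\mathrm{G}$ is left $\operatorname{Hom}_{\mathsf{A}}(\mathsf{W},-)$-exact if for each $\operatorname{Hom}_{\mathsf{A}}(\mathsf{W},-)$-exact short exact sequence $0\to A'\to A\to A''\to0$ the sequence $0\to\mathrm{G}(A')\to\mathrm{G}(A)\to\mathrm{G}(A'')$ is exact. *)

theory Defs
  imports "HOL-Algebra.Elementary_Groups"
begin

section \<open>Abelian categories\<close>

text \<open>
  Composition is written in the order of functions: \<open>g \<cdot> f\<close> means \<open>f\<close> first. All operations are
  meaningful only on the arguments on which the laws below constrain them (for instance
  \<open>Add\<close> only on parallel arrows).
\<close>

record ('o, 'm) cat =
  Obj :: "'o set"
  Arr :: "'m set"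
  Dom :: "'m \<Rightarrow> 'o"
  Cod :: "'m \<Rightarrow> 'o"
  Ide :: "'o \<Rightarrow> 'm"
  Comp :: "'m \<Rightarrow> 'm \<Rightarrow> 'm"  (infixr \<open>\<cdot>\<index>\<close> 70)
  Add :: "'m \<Rightarrow> 'm \<Rightarrow> 'm"
  Zero :: "'o \<Rightarrow> 'o \<Rightarrow> 'm"

definition mor :: "('o, 'm) cat \<Rightarrow> 'o \<Rightarrow> 'o \<Rightarrow> 'm set" where
  "mor A X Y = {f \<in> Arr A. Dom A f = X \<and> Cod A f = Y}"

definition hom_group :: "('o, 'm) cat \<Rightarrow> 'o \<Rightarrow> 'o \<Rightarrow> 'm monoid" where
  "hom_group A X Y = \<lparr>carrier = mor A X Y, mult = Add A, one = Zero A X Y\<rparr>"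

locale category =
  fixes A :: "('o, 'm) cat" (structure)
  assumes dom_in_Obj: "f \<in> Arr A \<Longrightarrow> Dom A f \<in> Obj A"
    and cod_in_Obj: "f \<in> Arr A \<Longrightarrow> Cod A f \<in> Obj A"
    and ide_in_mor: "X \<in> Obj A \<Longrightarrow> Ide A X \<in> mor A X X"
    and comp_in_mor: "\<lbrakk>f \<in> mor A X Y; g \<in> mor A Y Z\<rbrakk> \<Longrightarrow> g \<cdot> f \<in> mor A X Z"
    and comp_assoc:
      "\<lbrakk>f \<in> mor A X Y; g \<in> mor A Y Z; h \<in> mor A Z V\<rbrakk> \<Longrightarrow> (h \<cdot> g) \<cdot> f = h \<cdot> (g \<cdot> f)"
    and ide_left: "f \<in> mor A X Y \<Longrightarrow> Ide A Y \<cdot> f = f"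
    and ide_right: "f \<in> mor A X Y \<Longrightarrow> f \<cdot> Ide A X = f"

locale preadditive_category = category A for A :: "('o, 'm) cat" (structure) +
  assumes hom_comm_group: "\<lbrakk>X \<in> Obj A; Y \<in> Obj A\<rbrakk> \<Longrightarrow> comm_group (hom_group A X Y)"
    and comp_add_right: "\<lbrakk>f \<in> mor A X Y; f' \<in> mor A X Y; g \<in> mor A Y Z\<rbrakk>
      \<Longrightarrow> g \<cdot> Add A f f' = Add A (g \<cdot> f) (g \<cdot> f')"
    and comp_add_left: "\<lbrakk>f \<in> mor A X Y; g \<in> mor A Y Z; g' \<in> mor A Y Z\<rbrakk>
      \<Longrightarrow> Add A g g' \<cdot> f = Add A (g \<cdot> f) (g' \<cdot> f)"

definition is_zero_object :: "('o, 'm) cat \<Rightarrow> 'o \<Rightarrow> bool" where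
  "is_zero_object A Z \<longleftrightarrow> Z \<in> Obj A \<and>
     (\<forall>X \<in> Obj A. (\<exists>!f. f \<in> mor A Z X) \<and> (\<exists>!f. f \<in> mor A X Z))"

definition is_biproduct ::
  "('o, 'm) cat \<Rightarrow> 'o \<Rightarrow> 'o \<Rightarrow> 'o \<Rightarrow> 'm \<Rightarrow> 'm \<Rightarrow> 'm \<Rightarrow> 'm \<Rightarrow> bool" where
  "is_biproduct A X Y S i j p q \<longleftrightarrow>
     i \<in> mor A X S \<and> j \<in> mor A Y S \<and> p \<in> mor A S X \<and> q \<in> mor A S Y \<and>
     p \<cdot>\<^bsub>A\<^esub> i = Ide A X \<and> q \<cdot>\<^bsub>A\<^esub> j = Ide A Y \<and>
     Add A (i \<cdot>\<^bsub>A\<^esub> p) (j \<cdot>\<^bsub>A\<^esub> q) = Ide A S"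

locale additive_category = preadditive_category A for A :: "('o, 'm) cat" (structure) +
  assumes ex_zero_object: "\<exists>Z. is_zero_object A Z"
    and ex_biproduct: "\<lbrakk>X \<in> Obj A; Y \<in> Obj A\<rbrakk> \<Longrightarrow> \<exists>S i j p q. is_biproduct A X Y S i j p q"

definition is_mono :: "('o, 'm) cat \<Rightarrow> 'm \<Rightarrow> bool" where
  "is_mono A f \<longleftrightarrow> f \<in> Arr A \<and>
     (\<forall>X. \<forall>g \<in> mor A X (Dom A f). \<forall>h \<in> mor A X (Dom A f). f \<cdot>\<^bsub>A\<^esub> g = f \<cdot>\<^bsub>A\<^esub> h \<longrightarrow> g = h)"

definition is_epi :: "('o, 'm) cat \<Rightarrow> 'm \<Rightarrow> bool" where
  "is_epi A f \<longleftrightarrow> f \<in> Arr A \<and>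
     (\<forall>X. \<forall>g \<in> mor A (Cod A f) X. \<forall>h \<in> mor A (Cod A f) X. g \<cdot>\<^bsub>A\<^esub> f = h \<cdot>\<^bsub>A\<^esub> f \<longrightarrow> g = h)"

definition is_iso :: "('o, 'm) cat \<Rightarrow> 'm \<Rightarrow> bool" where
  "is_iso A f \<longleftrightarrow> f \<in> Arr A \<and>
     (\<exists>g \<in> mor A (Cod A f) (Dom A f).
        g \<cdot>\<^bsub>A\<^esub> f = Ide A (Dom A f) \<and> f \<cdot>\<^bsub>A\<^esub> g = Ide A (Cod A f))"

definition is_kernel :: "('o, 'm) cat \<Rightarrow> 'm \<Rightarrow> 'm \<Rightarrow> bool" where
  "is_kernel A f k \<longleftrightarrow> f \<in> Arr A \<and> k \<in> Arr A \<and> Cod A k = Dom A f \<and>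
     f \<cdot>\<^bsub>A\<^esub> k = Zero A (Dom A k) (Cod A f) \<and>
     (\<forall>X. \<forall>h \<in> mor A X (Dom A f). f \<cdot>\<^bsub>A\<^esub> h = Zero A X (Cod A f) \<longrightarrow>
        (\<exists>!u. u \<in> mor A X (Dom A k) \<and> k \<cdot>\<^bsub>A\<^esub> u = h))"

definition is_cokernel :: "('o, 'm) cat \<Rightarrow> 'm \<Rightarrow> 'm \<Rightarrow> bool" where
  "is_cokernel A f c \<longleftrightarrow> f \<in> Arr A \<and> c \<in> Arr A \<and> Dom A c = Cod A f \<and>
     c \<cdot>\<^bsub>A\<^esub> f = Zero A (Dom A f) (Cod A c) \<and>
     (\<forall>X. \<forall>h \<in> mor A (Cod A f) X. h \<cdot>\<^bsub>A\<^esub> f = Zero A (Dom A f) X \<longrightarrow>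
        (\<exists>!u. u \<in> mor A (Cod A c) X \<and> u \<cdot>\<^bsub>A\<^esub> c = h))"

locale abelian_category = additive_category A for A :: "('o, 'm) cat" (structure) +
  assumes ex_kernel: "f \<in> Arr A \<Longrightarrow> \<exists>k. is_kernel A f k"
    and ex_cokernel: "f \<in> Arr A \<Longrightarrow> \<exists>c. is_cokernel A f c"
    and mono_is_kernel: "is_mono A k \<Longrightarrow> \<exists>f. is_kernel A f k"
    and epi_is_cokernel: "is_epi A c \<Longrightarrow> \<exists>f. is_cokernel A f c"

text \<open>The image of \<open>f\<close>, as the kernel of its cokernel.\<close>

definition is_image :: "('o, 'm) cat \<Rightarrow> 'm \<Rightarrow> 'm \<Rightarrow> bool" where
  "is_image A f k \<longleftrightarrow> (\<exists>c. is_cokernel A f c \<and> is_kernel A c k)"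

definition exact_at :: "('o, 'm) cat \<Rightarrow> 'm \<Rightarrow> 'm \<Rightarrow> bool" where
  "exact_at A f g \<longleftrightarrow> Cod A f = Dom A g \<and> (\<exists>k. is_image A f k \<and> is_kernel A g k)"

text \<open>Exactness of \<open>0 \<rightarrow> Dom f \<rightarrow> Cod f = Dom g \<rightarrow> Cod g \<rightarrow> 0\<close>.\<close>

definition short_exact :: "('o, 'm) cat \<Rightarrow> 'm \<Rightarrow> 'm \<Rightarrow> bool" where
  "short_exact A f g \<longleftrightarrow> (\<exists>Z. is_zero_object A Z \<and>
     exact_at A (Zero A Z (Dom A f)) f \<and> exact_at A f g \<and> exact_at A g (Zero A (Cod A g) Z))"

definition full_sub :: "('o, 'm) cat \<Rightarrow> 'o set \<Rightarrow> ('o, 'm) cat" where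
  "full_sub A W = A\<lparr>Obj := W, Arr := {f \<in> Arr A. Dom A f \<in> W \<and> Cod A f \<in> W}\<rparr>"

text \<open>Full additive subcategories closed under isomorphisms, given by their sets of objects.\<close>

definition subcategory :: "('o, 'm) cat \<Rightarrow> 'o set \<Rightarrow> bool" where
  "subcategory A W \<longleftrightarrow> W \<subseteq> Obj A \<and> additive_category (full_sub A W) \<and>
     (\<forall>f. is_iso A f \<and> Dom A f \<in> W \<longrightarrow> Cod A f \<in> W)"


section \<open>Yoneda Ext and special precovers\<close>

text \<open>An extension \<open>0 \<rightarrow> N \<rightarrow> E \<rightarrow> X \<rightarrow> 0\<close> is represented by its pair of arrows.\<close>

definition extensions :: "('o, 'm) cat \<Rightarrow> 'o \<Rightarrow> 'o \<Rightarrow> ('m \<times> 'm) set" where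
  "extensions A X N = {(f, g). short_exact A f g \<and> Dom A f = N \<and> Cod A g = X}"

definition ext_equiv :: "('o, 'm) cat \<Rightarrow> 'o \<Rightarrow> 'o \<Rightarrow> (('m \<times> 'm) \<times> ('m \<times> 'm)) set" where
  "ext_equiv A X N = {((f, g), (f', g')).
     (f, g) \<in> extensions A X N \<and> (f', g') \<in> extensions A X N \<and>
     (\<exists>h \<in> mor A (Cod A f) (Cod A f'). is_iso A h \<and> h \<cdot>\<^bsub>A\<^esub> f = f' \<and> g' \<cdot>\<^bsub>A\<^esub> h = g)}"

text \<open>
  \<open>Ext\<^sup>1(X, N)\<close> is the set of equivalence classes of extensions; the zero element of this group
  is the class of the split extension \<open>0 \<rightarrow> N \<rightarrow> N \<oplus> X \<rightarrow> X \<rightarrow> 0\<close>. The Baer sum is not needed in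
  order to say that the group is zero.
\<close>

definition Ext1 :: "('o, 'm) cat \<Rightarrow> 'o \<Rightarrow> 'o \<Rightarrow> ('m \<times> 'm) set set" where
  "Ext1 A X N = extensions A X N // ext_equiv A X N"

definition Ext1_zero :: "('o, 'm) cat \<Rightarrow> 'o \<Rightarrow> 'o \<Rightarrow> ('m \<times> 'm) set" where
  "Ext1_zero A X N =
     {e. \<exists>S i j p q. is_biproduct A N X S i j p q \<and> ((i, q), e) \<in> ext_equiv A X N}"

definition right_perp :: "('o, 'm) cat \<Rightarrow> 'o set \<Rightarrow> 'o set" where
  "right_perp A W = {N \<in> Obj A. \<forall>X \<in> W. Ext1 A X N = {Ext1_zero A X N}}"

definition special_precovering :: "('o, 'm) cat \<Rightarrow> 'o set \<Rightarrow> bool" where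
  "special_precovering A W \<longleftrightarrow> (\<forall>M \<in> Obj A. \<exists>f g. short_exact A f g \<and>
     Cod A g = M \<and> Dom A g \<in> W \<and> Dom A f \<in> right_perp A W)"


section \<open>Additive functors to abelian groups\<close>

text \<open>
  Abelian groups are written multiplicatively, as in HOL-Algebra. Homomorphisms are only
  relevant on the carriers.
\<close>

record ('o, 'm, 'g) ab_functor =
  Fo :: "'o \<Rightarrow> 'g monoid"
  Fm :: "'m \<Rightarrow> 'g \<Rightarrow> 'g"

definition additive_functor :: "('o, 'm) cat \<Rightarrow> ('o, 'm, 'g) ab_functor \<Rightarrow> bool" where
  "additive_functor A F \<longleftrightarrow>
     (\<forall>X \<in> Obj A. comm_group (Fo F X)) \<and>
     (\<forall>f \<in> Arr A. Fm F f \<in> hom (Fo F (Dom A f)) (Fo F (Cod A f))) \<and>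
     (\<forall>X \<in> Obj A. \<forall>x \<in> carrier (Fo F X). Fm F (Ide A X) x = x) \<and>
     (\<forall>X Y Z. \<forall>f \<in> mor A X Y. \<forall>g \<in> mor A Y Z. \<forall>x \<in> carrier (Fo F X).
        Fm F (g \<cdot>\<^bsub>A\<^esub> f) x = Fm F g (Fm F f x)) \<and>
     (\<forall>X Y. \<forall>f \<in> mor A X Y. \<forall>g \<in> mor A X Y. \<forall>x \<in> carrier (Fo F X).
        Fm F (Add A f g) x = Fm F f x \<otimes>\<^bsub>Fo F Y\<^esub> Fm F g x)"

definition hom_functor :: "('o, 'm) cat \<Rightarrow> 'o \<Rightarrow> ('o, 'm, 'm) ab_functor" where
  "hom_functor A X = \<lparr>Fo = hom_group A X, Fm = Comp A\<rparr>"

text \<open>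
  Exactness of \<open>F X \<rightarrow> F Y \<rightarrow> F Z\<close> for \<open>f: X \<rightarrow> Y\<close> and \<open>g: Y \<rightarrow> Z\<close>, of
  \<open>0 \<rightarrow> F X \<rightarrow> F Y\<close> and of \<open>F X \<rightarrow> F Y \<rightarrow> 0\<close>, all in the category of abelian groups.
\<close>

definition F_exact :: "('o, 'm) cat \<Rightarrow> ('o, 'm, 'g) ab_functor \<Rightarrow> 'm \<Rightarrow> 'm \<Rightarrow> bool" where
  "F_exact A F f g \<longleftrightarrow>
     Fm F f ` carrier (Fo F (Dom A f)) = kernel (Fo F (Dom A g)) (Fo F (Cod A g)) (Fm F g)"

definition F_injective :: "('o, 'm) cat \<Rightarrow> ('o, 'm, 'g) ab_functor \<Rightarrow> 'm \<Rightarrow> bool" where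
  "F_injective A F f \<longleftrightarrow> inj_on (Fm F f) (carrier (Fo F (Dom A f)))"

definition F_surjective :: "('o, 'm) cat \<Rightarrow> ('o, 'm, 'g) ab_functor \<Rightarrow> 'm \<Rightarrow> bool" where
  "F_surjective A F f \<longleftrightarrow> Fm F f ` carrier (Fo F (Dom A f)) = carrier (Fo F (Cod A f))"

definition hom_exact_short :: "('o, 'm) cat \<Rightarrow> 'o set \<Rightarrow> 'm \<Rightarrow> 'm \<Rightarrow> bool" where
  "hom_exact_short A W f g \<longleftrightarrow> (\<forall>X \<in> W.
     F_injective A (hom_functor A X) f \<and> F_exact A (hom_functor A X) f g \<and>
     F_surjective A (hom_functor A X) g)"

definition left_hom_exact :: "('o, 'm) cat \<Rightarrow> 'o set \<Rightarrow> ('o, 'm, 'g) ab_functor \<Rightarrow> bool" where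
  "left_hom_exact A W F \<longleftrightarrow> additive_functor A F \<and>
     (\<forall>f g. short_exact A f g \<and> hom_exact_short A W f g \<longrightarrow>
        F_injective A F f \<and> F_exact A F f g)"


section \<open>Proper resolutions and syzygies\<close>

text \<open>\<open>diff P i\<close> is the differential \<open>P\<^sub>i\<^sub>+\<^sub>1 \<rightarrow> P\<^sub>i\<close>, and \<open>aug P\<close> the augmentation \<open>P\<^sub>0 \<rightarrow> N\<close>.\<close>

record ('o, 'm) resolution =
  term_at :: "nat \<Rightarrow> 'o"
  diff :: "nat \<Rightarrow> 'm"
  aug :: "'m"

definition proper_resolution ::
  "('o, 'm) cat \<Rightarrow> 'o set \<Rightarrow> 'o \<Rightarrow> ('o, 'm) resolution \<Rightarrow> bool" where
  "proper_resolution A W N P \<longleftrightarrow>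
     (\<forall>i. term_at P i \<in> W) \<and>
     (\<forall>i. diff P i \<in> mor A (term_at P (Suc i)) (term_at P i)) \<and>
     aug P \<in> mor A (term_at P 0) N \<and>
     (\<forall>i. exact_at A (diff P (Suc i)) (diff P i)) \<and>
     exact_at A (diff P 0) (aug P) \<and>
     (\<exists>Z. is_zero_object A Z \<and> exact_at A (aug P) (Zero A N Z)) \<and>
     (\<forall>X \<in> W.
        (\<forall>i. F_exact A (hom_functor A X) (diff P (Suc i)) (diff P i)) \<and>
        F_exact A (hom_functor A X) (diff P 0) (aug P) \<and>
        F_surjective A (hom_functor A X) (aug P))"

text \<open>
  Cokernels are determined up to isomorphism, and both \<open>right_perp A W\<close> and the notion of syzygy
  are invariant under isomorphism, so any cokernel of \<open>P\<^sub>i\<^sub>+\<^sub>1 \<rightarrow> P\<^sub>i\<close> may be used.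
\<close>

definition special_proper_resolution ::
  "('o, 'm) cat \<Rightarrow> 'o set \<Rightarrow> 'o \<Rightarrow> ('o, 'm) resolution \<Rightarrow> bool" where
  "special_proper_resolution A W N P \<longleftrightarrow> proper_resolution A W N P \<and>
     (\<forall>i \<ge> 1. \<forall>c. is_cokernel A (diff P i) c \<longrightarrow> Cod A c \<in> right_perp A W)"

definition is_syzygy :: "('o, 'm) cat \<Rightarrow> 'o set \<Rightarrow> nat \<Rightarrow> 'o \<Rightarrow> 'o \<Rightarrow> bool" where
  "is_syzygy A W i N K \<longleftrightarrow> (\<exists>P c. special_proper_resolution A W N P \<and>
     is_cokernel A (diff P i) c \<and> Cod A c = K)"


section \<open>The stable functor\<close>

text \<open>The cokernel of \<open>h: H \<rightarrow> K\<close> in abelian groups; its elements are cosets of the image.\<close>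

definition ab_coker :: "'a monoid \<Rightarrow> 'b monoid \<Rightarrow> ('a \<Rightarrow> 'b) \<Rightarrow> 'b set monoid" where
  "ab_coker H K h = K Mod (h ` carrier H)"

text \<open>
  The map into \<open>ab_coker H K h\<close> induced by a homomorphism \<open>c\<close> with target \<open>K\<close>: it sends the coset
  of \<open>x\<close> to the coset of \<open>c x\<close>.
\<close>

definition ab_coker_map ::
  "'a monoid \<Rightarrow> 'b monoid \<Rightarrow> ('a \<Rightarrow> 'b) \<Rightarrow> ('c \<Rightarrow> 'b) \<Rightarrow> 'c set \<Rightarrow> 'b set" where
  "ab_coker_map H K h c C = (h ` carrier H) <#>\<^bsub>K\<^esub> (c ` C)"

text \<open>
  In the following \<open>P\<close> assigns to every object a proper resolution. On an arrow \<open>g: N \<rightarrow> N'\<close>, the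
  functor \<open>L\<^sub>0G\<close> is induced by \<open>G\<close> of any lift of \<open>g\<close> to the terms of degree \<open>0\<close>.
\<close>

definition lift0 :: "('o, 'm) cat \<Rightarrow> ('o \<Rightarrow> ('o, 'm) resolution) \<Rightarrow> 'm \<Rightarrow> 'm" where
  "lift0 A P g = (SOME u. u \<in> mor A (term_at (P (Dom A g)) 0) (term_at (P (Cod A g)) 0) \<and>
     aug (P (Cod A g)) \<cdot>\<^bsub>A\<^esub> u = g \<cdot>\<^bsub>A\<^esub> aug (P (Dom A g)))"

definition L0 :: "('o, 'm) cat \<Rightarrow> ('o \<Rightarrow> ('o, 'm) resolution) \<Rightarrow> ('o, 'm, 'g) ab_functor
    \<Rightarrow> ('o, 'm, 'g set) ab_functor" where
  "L0 A P G = \<lparr>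
     Fo = (\<lambda>N. ab_coker (Fo G (term_at (P N) 1)) (Fo G (term_at (P N) 0)) (Fm G (diff (P N) 0))),
     Fm = (\<lambda>g. let N = Cod A g in
       ab_coker_map (Fo G (term_at (P N) 1)) (Fo G (term_at (P N) 0)) (Fm G (diff (P N) 0))
         (Fm G (lift0 A P g)))\<rparr>"

text \<open>
  The natural transformation \<open>L\<^sub>0G \<rightarrow> G\<close> at \<open>N\<close>: \<open>G\<close> of the augmentation is constant on each coset
  of the image of \<open>G(P\<^sub>1)\<close>, and \<open>the_elem\<close> picks that value.
\<close>

definition rho :: "('o \<Rightarrow> ('o, 'm) resolution) \<Rightarrow> ('o, 'm, 'g) ab_functor \<Rightarrow> 'o \<Rightarrow> 'g set \<Rightarrow> 'g" where
  "rho P G N = (\<lambda>C. the_elem (Fm G (aug (P N)) ` C))"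

definition stable_functor :: "('o, 'm) cat \<Rightarrow> ('o \<Rightarrow> ('o, 'm) resolution)
    \<Rightarrow> ('o, 'm, 'g) ab_functor \<Rightarrow> ('o, 'm, 'g set) ab_functor" where
  "stable_functor A P G = \<lparr>
     Fo = (\<lambda>N. ab_coker (Fo (L0 A P G) N) (Fo G N) (rho P G N)),
     Fm = (\<lambda>g. let N = Cod A g in ab_coker_map (Fo (L0 A P G) N) (Fo G N) (rho P G N) (Fm G g))\<rparr>"

end

theory Submission
  imports Defs
begin

text \<open>
  The image of \<open>G(P\<^sub>0) \<rightarrow> G(N)\<close> contains \<open>G(f)(G(X))\<close> for every \<open>f: X \<rightarrow> N\<close> with
  \<open>X \<in> W\<close>, so the stable functor divides \<open>G(N)\<close> by the elements coming from \<open>W\<close>. All three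
  conditions are equivalent to its vanishing on the kernel of every epic precover. By left
  exactness such a kernel injects into an object of \<open>W\<close>, on which the stable functor is zero.
  Conversely, let \<open>0 \<rightarrow> X \<rightarrow> Y \<rightarrow> Z \<rightarrow> 0\<close> be exact and let \<open>x \<in> G(X)\<close> become stably zero in
  \<open>G(Y)\<close>. Then its image comes from some \<open>w \<in> G(V)\<close> for a precover \<open>V \<rightarrow> Y\<close>, and \<open>w\<close> lies in
  \<open>G\<close> of the kernel of the precover \<open>V \<rightarrow> Y \<rightarrow> Z\<close>; as this kernel is stably zero, so is \<open>x\<close>.
\<close>

section \<open>Kernels and exactness in abelian categories\<close>

context category
begin

lemma mor_Arr: "f \<in> mor A X Y \<Longrightarrow> f \<in> Arr A"
  and mor_Dom: "f \<in> mor A X Y \<Longrightarrow> Dom A f = X"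
  and mor_Cod: "f \<in> mor A X Y \<Longrightarrow> Cod A f = Y"
  by (auto simp: mor_def)

lemma mor_Dom_Obj: "f \<in> mor A X Y \<Longrightarrow> X \<in> Obj A"
  and mor_Cod_Obj: "f \<in> mor A X Y \<Longrightarrow> Y \<in> Obj A"
  using dom_in_Obj cod_in_Obj by (auto simp: mor_def)

lemma Arr_mor: "f \<in> Arr A \<Longrightarrow> f \<in> mor A (Dom A f) (Cod A f)"
  by (auto simp: mor_def)

lemma monoD:
  "\<lbrakk>is_mono A f; f \<in> mor A X Y; g \<in> mor A T X; h \<in> mor A T X; f \<cdot> g = f \<cdot> h\<rbrakk> \<Longrightarrow> g = h"
  by (auto simp: is_mono_def mor_Dom)

lemma epiD:
  "\<lbrakk>is_epi A f; f \<in> mor A X Y; g \<in> mor A Y T; h \<in> mor A Y T; g \<cdot> f = h \<cdot> f\<rbrakk> \<Longrightarrow> g = h"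
  by (auto simp: is_epi_def mor_Cod)

lemma epi_comp:
  assumes f: "f \<in> mor A X Y" "is_epi A f" and g: "g \<in> mor A Y Z" "is_epi A g"
  shows "is_epi A (g \<cdot> f)"
proof -
  have gf: "g \<cdot> f \<in> mor A X Z" using f g comp_in_mor by blast
  have "a = b" if "a \<in> mor A Z T" "b \<in> mor A Z T" "a \<cdot> (g \<cdot> f) = b \<cdot> (g \<cdot> f)" for a b T
  proof -
    have ag: "a \<cdot> g \<in> mor A Y T" "b \<cdot> g \<in> mor A Y T" using comp_in_mor[OF g(1)] that by auto
    have "(a \<cdot> g) \<cdot> f = (b \<cdot> g) \<cdot> f" using that comp_assoc[OF f(1) g(1)] by simp
    then have "a \<cdot> g = b \<cdot> g" by (rule epiD[OF f(2,1) ag])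
    then show ?thesis by (rule epiD[OF g(2,1) that(1,2)])
  qed
  then show ?thesis using gf unfolding is_epi_def mor_Cod[OF gf] by (blast dest: mor_Arr)
qed

lemma kernel_in_mor: "is_kernel A f k \<Longrightarrow> f \<in> mor A X Y \<Longrightarrow> k \<in> mor A (Dom A k) X"
  and kernel_zero: "is_kernel A f k \<Longrightarrow> f \<in> mor A X Y \<Longrightarrow> f \<cdot> k = Zero A (Dom A k) Y"
  by (auto simp: is_kernel_def mor_def)

lemma kernel_factor:
  assumes k: "is_kernel A f k" and f: "f \<in> mor A X Y" and K: "k \<in> mor A K X"
    and h: "h \<in> mor A T X" "f \<cdot> h = Zero A T Y"
  obtains u where "u \<in> mor A T K" "k \<cdot> u = h"
proof -
  have "\<exists>!u. u \<in> mor A T K \<and> k \<cdot> u = h"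
    using k h unfolding is_kernel_def mor_Dom[OF f] mor_Cod[OF f] mor_Dom[OF K] by blast
  then show ?thesis using that by blast
qed

lemma cokernel_in_mor: "is_cokernel A f c \<Longrightarrow> f \<in> mor A X Y \<Longrightarrow> c \<in> mor A Y (Cod A c)"
  and cokernel_zero: "is_cokernel A f c \<Longrightarrow> f \<in> mor A X Y \<Longrightarrow> c \<cdot> f = Zero A X (Cod A c)"
  by (auto simp: is_cokernel_def mor_def)

lemma cokernel_factor:
  assumes c: "is_cokernel A f c" and f: "f \<in> mor A X Y" and C: "c \<in> mor A Y C"
    and h: "h \<in> mor A Y T" "h \<cdot> f = Zero A X T"
  obtains u where "u \<in> mor A C T" "u \<cdot> c = h"
proof -
  have "\<exists>!u. u \<in> mor A C T \<and> u \<cdot> c = h"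
    using c h unfolding is_cokernel_def mor_Dom[OF f] mor_Cod[OF f] mor_Cod[OF C] by blast
  then show ?thesis using that by blast
qed

end

section \<open>Arithmetic of arrows\<close>

context preadditive_category
begin

lemma zero_in_mor: "X \<in> Obj A \<Longrightarrow> Y \<in> Obj A \<Longrightarrow> Zero A X Y \<in> mor A X Y"
  using hom_comm_group[of X Y] monoid.one_closed[of "hom_group A X Y"]
  by (simp add: hom_group_def comm_group_def group_def)

lemma add_in_mor: "f \<in> mor A X Y \<Longrightarrow> g \<in> mor A X Y \<Longrightarrow> Add A f g \<in> mor A X Y"
  using hom_comm_group[of X Y] monoid.m_closed[of "hom_group A X Y" f g] mor_Dom_Obj mor_Cod_Obj
  by (simp add: hom_group_def comm_group_def group_def)

lemma add_zero_right: "f \<in> mor A X Y \<Longrightarrow> Add A f (Zero A X Y) = f"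
  using hom_comm_group[of X Y] monoid.r_one[of "hom_group A X Y" f] mor_Dom_Obj mor_Cod_Obj
  by (simp add: hom_group_def comm_group_def group_def)

lemma add_cancel:
  assumes "f \<in> mor A X Y" "g \<in> mor A X Y" "h \<in> mor A X Y" "Add A f g = Add A f h"
  shows "g = h"
proof -
  interpret comm_group "hom_group A X Y"
    using assms hom_comm_group mor_Dom_Obj mor_Cod_Obj by blast
  show ?thesis using assms Units_l_cancel[of f g h, unfolded Units_eq] by (simp add: hom_group_def)
qed

text \<open>The record \<open>cat\<close> has no subtraction. The difference of two arrows is
  therefore the solution \<open>d\<close> of an equation, and composites with \<open>d\<close> are
  computed by bilinearity and cancellation.\<close>

lemma ex_difference:
  assumes "f \<in> mor A X Y" "g \<in> mor A X Y"
  obtains d where "d \<in> mor A X Y" "f = Add A g d"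
proof -
  let ?H = "hom_group A X Y"
  interpret comm_group ?H using assms hom_comm_group mor_Dom_Obj mor_Cod_Obj by blast
  have c: "f \<in> carrier ?H" "g \<in> carrier ?H" using assms by (simp_all add: hom_group_def)
  then have "g \<otimes>\<^bsub>?H\<^esub> (inv\<^bsub>?H\<^esub> g \<otimes>\<^bsub>?H\<^esub> f) = f" by (simp add: m_assoc[symmetric])
  moreover have "inv\<^bsub>?H\<^esub> g \<otimes>\<^bsub>?H\<^esub> f \<in> mor A X Y" using c m_closed inv_closed
    by (simp add: hom_group_def)
  ultimately show ?thesis using that by (simp add: hom_group_def)
qed

text \<open>The composite is additively idempotent, and in a group only the neutral element
  is.\<close>

lemma comp_zero_right:
  assumes "f \<in> mor A X Y" "T \<in> Obj A"
  shows "f \<cdot> Zero A T X = Zero A T Y"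
proof -
  have z: "Zero A T X \<in> mor A T X" using assms zero_in_mor mor_Dom_Obj by blast
  have z': "f \<cdot> Zero A T X \<in> mor A T Y" using z assms comp_in_mor by blast
  have "Add A (f \<cdot> Zero A T X) (f \<cdot> Zero A T X) = f \<cdot> Zero A T X"
    using comp_add_right[OF z z assms(1)] add_zero_right[OF z] by simp
  then show ?thesis
    using add_cancel[OF z' z' zero_in_mor] add_zero_right[OF z'] assms mor_Cod_Obj[OF z'] by simp
qed

lemma comp_zero_left:
  assumes "f \<in> mor A X Y" "T \<in> Obj A"
  shows "Zero A Y T \<cdot> f = Zero A X T"
proof -
  have z: "Zero A Y T \<in> mor A Y T" using assms zero_in_mor mor_Cod_Obj by blast
  have z': "Zero A Y T \<cdot> f \<in> mor A X T" using z assms comp_in_mor by blast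
  have "Add A (Zero A Y T \<cdot> f) (Zero A Y T \<cdot> f) = Zero A Y T \<cdot> f"
    using comp_add_left[OF assms(1) z z] add_zero_right[OF z] by simp
  then show ?thesis
    using add_cancel[OF z' z' zero_in_mor] add_zero_right[OF z'] assms mor_Dom_Obj[OF z'] by simp
qed

lemma difference_in_kernel:
  assumes "g \<in> mor A X Y" "d \<in> mor A X Y" "e \<in> mor A Y Z" "e \<cdot> Add A g d = e \<cdot> g"
  shows "e \<cdot> d = Zero A X Z"
proof -
  have m: "e \<cdot> g \<in> mor A X Z" "e \<cdot> d \<in> mor A X Z" using assms comp_in_mor by blast+
  have "Add A (e \<cdot> g) (e \<cdot> d) = Add A (e \<cdot> g) (Zero A X Z)"
    using comp_add_right[OF assms(1-3)] assms(4) add_zero_right[OF m(1)] by simp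
  then show ?thesis
    using add_cancel[OF m zero_in_mor] mor_Dom_Obj[OF m(1)] mor_Cod_Obj[OF m(1)] by simp
qed

lemma monoI:
  assumes f: "f \<in> mor A X Y" and "\<And>T t. t \<in> mor A T X \<Longrightarrow> f \<cdot> t = Zero A T Y \<Longrightarrow> t = Zero A T X"
  shows "is_mono A f"
proof -
  have "g = h" if gh: "g \<in> mor A T X" "h \<in> mor A T X" "f \<cdot> g = f \<cdot> h" for g h T
  proof -
    obtain d where d: "d \<in> mor A T X" "g = Add A h d" by (rule ex_difference[OF gh(1,2)])
    then have "f \<cdot> d = Zero A T Y" using difference_in_kernel[OF gh(2) d(1) f] gh(3) by simp
    then show ?thesis using d assms(2) add_zero_right[OF gh(2)] by simp
  qed
  then show ?thesis using mor_Arr[OF f] unfolding is_mono_def mor_Dom[OF f] by blast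
qed

lemma epiI:
  assumes f: "f \<in> mor A X Y" and z: "\<And>T t. t \<in> mor A Y T \<Longrightarrow> t \<cdot> f = Zero A X T \<Longrightarrow> t = Zero A Y T"
  shows "is_epi A f"
proof -
  have "g = h" if gh: "g \<in> mor A Y T" "h \<in> mor A Y T" "g \<cdot> f = h \<cdot> f" for g h T
  proof -
    obtain d where d: "d \<in> mor A Y T" "g = Add A h d" by (rule ex_difference[OF gh(1,2)])
    have m: "h \<cdot> f \<in> mor A X T" "d \<cdot> f \<in> mor A X T" using d gh f comp_in_mor by blast+
    have "Add A (h \<cdot> f) (d \<cdot> f) = Add A (h \<cdot> f) (Zero A X T)"
      using d(2) gh(3) comp_add_left[OF f gh(2) d(1)] add_zero_right[OF m(1)] by simp
    then have "d \<cdot> f = Zero A X T"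
      using add_cancel[OF m zero_in_mor] mor_Dom_Obj[OF m(1)] mor_Cod_Obj[OF m(1)] by simp
    then show ?thesis using d z add_zero_right[OF gh(2)] by simp
  qed
  then show ?thesis using mor_Arr[OF f] unfolding is_epi_def mor_Cod[OF f] by blast
qed

lemma mono_zeroD:
  assumes "is_mono A f" "f \<in> mor A X Y" "t \<in> mor A T X" "f \<cdot> t = Zero A T Y"
  shows "t = Zero A T X"
  using monoD[OF assms(1-3) zero_in_mor] comp_zero_right[OF assms(2)] assms(4)
    mor_Dom_Obj[OF assms(2)] mor_Dom_Obj[OF assms(3)] by simp

lemma epi_zeroD:
  assumes "is_epi A f" "f \<in> mor A X Y" "t \<in> mor A Y T" "t \<cdot> f = Zero A X T"
  shows "t = Zero A Y T"
  using epiD[OF assms(1-3) zero_in_mor] comp_zero_left[OF assms(2)] assms(4)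
    mor_Cod_Obj[OF assms(2)] mor_Cod_Obj[OF assms(3)] by simp

lemma is_kernelI:
  assumes f: "f \<in> mor A X Y" and k: "k \<in> mor A K X" "f \<cdot> k = Zero A K Y" and mono: "is_mono A k"
    and fac: "\<And>T h. h \<in> mor A T X \<Longrightarrow> f \<cdot> h = Zero A T Y \<Longrightarrow> \<exists>u \<in> mor A T K. k \<cdot> u = h"
  shows "is_kernel A f k"
proof -
  have "\<exists>!u. u \<in> mor A T K \<and> k \<cdot> u = h" if "h \<in> mor A T X" "f \<cdot> h = Zero A T Y" for T h
    using fac[OF that] monoD[OF mono k(1)] by blast
  then show ?thesis using f k unfolding is_kernel_def
    by (simp add: mor_Dom[OF f] mor_Cod[OF f] mor_Dom[OF k(1)] mor_Cod[OF k(1)] mor_Arr)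
qed

lemma is_cokernelI:
  assumes f: "f \<in> mor A X Y" and c: "c \<in> mor A Y C" "c \<cdot> f = Zero A X C" and epi: "is_epi A c"
    and fac: "\<And>T h. h \<in> mor A Y T \<Longrightarrow> h \<cdot> f = Zero A X T \<Longrightarrow> \<exists>u \<in> mor A C T. u \<cdot> c = h"
  shows "is_cokernel A f c"
proof -
  have "\<exists>!u. u \<in> mor A C T \<and> u \<cdot> c = h" if "h \<in> mor A Y T" "h \<cdot> f = Zero A X T" for T h
    using fac[OF that] epiD[OF epi c(1)] by blast
  then show ?thesis using f c unfolding is_cokernel_def
    by (simp add: mor_Dom[OF f] mor_Cod[OF f] mor_Dom[OF c(1)] mor_Cod[OF c(1)] mor_Arr)
qed

lemma kernel_mono:
  assumes "is_kernel A f k"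
  shows "is_mono A k"
proof -
  obtain X Y where f: "f \<in> mor A X Y" using assms by (auto simp: is_kernel_def mor_def)
  let ?K = "Dom A k"
  have k: "k \<in> mor A ?K X" "f \<cdot> k = Zero A ?K Y"
    using kernel_in_mor[OF assms f] kernel_zero[OF assms f] by auto
  have "g = h" if gh: "g \<in> mor A T ?K" "h \<in> mor A T ?K" "k \<cdot> g = k \<cdot> h" for T g h
  proof -
    have "f \<cdot> (k \<cdot> g) = Zero A T Y"
      using comp_assoc[OF gh(1) k(1) f] k(2) comp_zero_left[OF gh(1)] mor_Cod_Obj[OF f] by simp
    moreover have "k \<cdot> g \<in> mor A T X" using gh k comp_in_mor by blast
    ultimately have "\<exists>!u. u \<in> mor A T ?K \<and> k \<cdot> u = k \<cdot> g"
      using assms unfolding is_kernel_def mor_Dom[OF f] mor_Cod[OF f] by blast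
    then show ?thesis using gh by metis
  qed
  then show ?thesis using mor_Arr[OF k(1)] unfolding is_mono_def by blast
qed

lemma cokernel_epi:
  assumes "is_cokernel A f c"
  shows "is_epi A c"
proof -
  obtain X Y where f: "f \<in> mor A X Y" using assms by (auto simp: is_cokernel_def mor_def)
  let ?C = "Cod A c"
  have c: "c \<in> mor A Y ?C" "c \<cdot> f = Zero A X ?C"
    using cokernel_in_mor[OF assms f] cokernel_zero[OF assms f] by auto
  have "g = h" if gh: "g \<in> mor A ?C T" "h \<in> mor A ?C T" "g \<cdot> c = h \<cdot> c" for T g h
  proof -
    have "(g \<cdot> c) \<cdot> f = Zero A X T"
      using comp_assoc[OF f c(1) gh(1)] c(2) comp_zero_right[OF gh(1)] mor_Dom_Obj[OF f] by simp
    moreover have "g \<cdot> c \<in> mor A Y T" using gh c comp_in_mor by blast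
    ultimately have "\<exists>!u. u \<in> mor A ?C T \<and> u \<cdot> c = g \<cdot> c"
      using assms unfolding is_cokernel_def mor_Dom[OF f] mor_Cod[OF f] by blast
    then show ?thesis using gh by metis
  qed
  then show ?thesis using mor_Arr[OF c(1)] unfolding is_epi_def by blast
qed

lemma ide_mono: "X \<in> Obj A \<Longrightarrow> is_mono A (Ide A X)"
  by (rule monoI[OF ide_in_mor]) (simp_all add: ide_left)

lemma ide_epi: "X \<in> Obj A \<Longrightarrow> is_epi A (Ide A X)"
  by (rule epiI[OF ide_in_mor]) (simp_all add: ide_right)

lemma mor_to_zero_object: "is_zero_object A Z \<Longrightarrow> t \<in> mor A T Z \<Longrightarrow> t = Zero A T Z"
  unfolding is_zero_object_def using zero_in_mor mor_Dom_Obj by metis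

lemma mor_from_zero_object: "is_zero_object A Z \<Longrightarrow> t \<in> mor A Z T \<Longrightarrow> t = Zero A Z T"
  unfolding is_zero_object_def using zero_in_mor mor_Cod_Obj by metis

end

section \<open>Normal monos and epis, and short exact sequences\<close>

context abelian_category
begin

text \<open>The mono \<open>m\<close> is the kernel of some \<open>f\<close>, and \<open>f\<close>
  factors through the cokernel \<open>c\<close>. Whatever \<open>c\<close> kills is then killed by
  \<open>f\<close> and so factors through \<open>m\<close>.\<close>

lemma mono_kernel_cokernel:
  assumes m: "m \<in> mor A X Y" "is_mono A m" and c: "is_cokernel A m c"
  shows "is_kernel A c m"
proof -
  obtain f where f: "is_kernel A f m" using mono_is_kernel m by blast
  then obtain Z where fm: "f \<in> mor A Y Z" using m by (auto simp: is_kernel_def mor_def)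
  have cm: "c \<in> mor A Y (Cod A c)" "c \<cdot> m = Zero A X (Cod A c)"
    using cokernel_in_mor[OF c m(1)] cokernel_zero[OF c m(1)] by auto
  have "f \<cdot> m = Zero A X Z" using kernel_zero[OF f fm] m by (simp add: mor_Dom)
  then obtain u where u: "u \<in> mor A (Cod A c) Z" "u \<cdot> c = f"
    using cokernel_factor[OF c m(1) cm(1) fm] by metis
  show ?thesis
  proof (rule is_kernelI[OF cm(1) m(1) cm(2) m(2)])
    fix T h assume h: "h \<in> mor A T Y" "c \<cdot> h = Zero A T (Cod A c)"
    then have "f \<cdot> h = Zero A T Z"
      using u comp_assoc[OF h(1) cm(1) u(1)] comp_zero_right[OF u(1)] mor_Dom_Obj by metis
    then show "\<exists>v \<in> mor A T X. m \<cdot> v = h" using kernel_factor[OF f fm m(1) h(1)] by metis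
  qed
qed

text \<open>Dual to the preceding argument: \<open>e\<close> is the cokernel of some
  \<open>f\<close>, and \<open>f\<close> factors through \<open>k\<close>, so an arrow that kills
  \<open>k\<close> also kills \<open>f\<close>.\<close>

lemma epi_cokernel_kernel:
  assumes e: "e \<in> mor A X Y" "is_epi A e" and k: "is_kernel A e k"
  shows "is_cokernel A k e"
proof -
  obtain f where f: "is_cokernel A f e" using epi_is_cokernel e by blast
  then obtain Z where fm: "f \<in> mor A Z X" using e by (auto simp: is_cokernel_def mor_def)
  have km: "k \<in> mor A (Dom A k) X" "e \<cdot> k = Zero A (Dom A k) Y"
    using kernel_in_mor[OF k e(1)] kernel_zero[OF k e(1)] by auto
  have "e \<cdot> f = Zero A Z Y" using cokernel_zero[OF f fm] e by (simp add: mor_Cod)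
  then obtain u where u: "u \<in> mor A Z (Dom A k)" "k \<cdot> u = f"
    using kernel_factor[OF k e(1) km(1) fm] by metis
  show ?thesis
  proof (rule is_cokernelI[OF km(1) e(1) km(2) e(2)])
    fix T h assume h: "h \<in> mor A X T" "h \<cdot> k = Zero A (Dom A k) T"
    then have "h \<cdot> f = Zero A Z T"
      using u comp_assoc[OF u(1) km(1) h(1)] comp_zero_left[OF u(1)] mor_Cod_Obj by metis
    then show "\<exists>v \<in> mor A Y T. v \<cdot> e = h" using cokernel_factor[OF f fm e(1) h(1)] by metis
  qed
qed

text \<open>
  If \<open>m \<cdot> t = 0\<close>, then \<open>d\<close> factors through \<open>q \<cdot> e\<close>, where \<open>q\<close> is the cokernel of \<open>t\<close>. The epi
  \<open>q \<cdot> e\<close> therefore has no larger kernel than \<open>e\<close>, so \<open>q\<close> is a split mono, and \<open>q \<cdot> t = 0\<close>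
  gives \<open>t = 0\<close>.
\<close>

lemma mono_part:
  assumes d: "d \<in> mor A X Y" and e: "e \<in> mor A X N" "is_epi A e" and m: "m \<in> mor A N Y"
    and fac: "m \<cdot> e = d" and k: "is_kernel A d k" and ek: "e \<cdot> k = Zero A (Dom A k) N"
  shows "is_mono A m"
proof (rule monoI[OF m])
  fix T t assume t: "t \<in> mor A T N" "m \<cdot> t = Zero A T Y"
  have km: "k \<in> mor A (Dom A k) X" using kernel_in_mor[OF k d] .
  obtain q where q: "is_cokernel A t q" using ex_cokernel t mor_Arr by blast
  let ?Q = "Cod A q"
  have qm: "q \<in> mor A N ?Q" using cokernel_in_mor[OF q t(1)] .
  obtain m' where m': "m' \<in> mor A ?Q Y" "m' \<cdot> q = m" using cokernel_factor[OF q t(1) qm m t(2)] .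
  have qe: "q \<cdot> e \<in> mor A X ?Q" using e qm comp_in_mor by blast
  have "is_epi A (q \<cdot> e)" using epi_comp[OF e qm cokernel_epi[OF q]] .
  then obtain s where s: "is_cokernel A s (q \<cdot> e)" using epi_is_cokernel by blast
  then obtain S where sm: "s \<in> mor A S X" using qe by (auto simp: is_cokernel_def mor_def)
  have "(q \<cdot> e) \<cdot> s = Zero A S ?Q" using cokernel_zero[OF s sm] qe by (simp add: mor_Cod)
  moreover have "d = m' \<cdot> (q \<cdot> e)" using fac m' comp_assoc[OF e(1) qm m'(1)] by simp
  ultimately have "d \<cdot> s = Zero A S Y"
    using comp_assoc[OF sm qe m'(1)] comp_zero_right[OF m'(1)] mor_Dom_Obj[OF sm] by metis
  then obtain s' where s': "s' \<in> mor A S (Dom A k)" "k \<cdot> s' = s"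
    using kernel_factor[OF k d km sm] by metis
  have "e \<cdot> s = Zero A S N"
    using s' comp_assoc[OF s'(1) km e(1)] ek comp_zero_left[OF s'(1)] mor_Cod_Obj[OF e(1)] by metis
  then obtain r where r: "r \<in> mor A ?Q N" "r \<cdot> (q \<cdot> e) = e"
    using cokernel_factor[OF s sm qe e(1)] by metis
  have N: "N \<in> Obj A" using m mor_Dom_Obj by blast
  have "(r \<cdot> q) \<cdot> e = Ide A N \<cdot> e"
    using r comp_assoc[OF e(1) qm r(1)] ide_left[OF e(1)] by simp
  then have "r \<cdot> q = Ide A N"
    using epiD[OF e(2,1)] comp_in_mor[OF qm r(1)] ide_in_mor[OF N] by blast
  then have "t = r \<cdot> (q \<cdot> t)" using comp_assoc[OF t(1) qm r(1)] ide_left[OF t(1)] by simp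
  then show "t = Zero A T N"
    using cokernel_zero[OF q t(1)] comp_zero_right[OF r(1)] mor_Dom_Obj[OF t(1)] by simp
qed

text \<open>The kernel of \<open>f\<close> is the image of the zero arrow, so it is killed by the
  cokernel \<open>c\<close> of that arrow. But \<open>c\<close> has a retraction, because the
  identity of \<open>X\<close> kills the zero arrow and hence factors through
  \<open>c\<close>.\<close>

lemma exact_zero_mono:
  assumes f: "f \<in> mor A X Y" and Z: "is_zero_object A Z" and ex: "exact_at A (Zero A Z X) f"
  shows "is_mono A f"
proof (rule monoI[OF f])
  fix T t assume t: "t \<in> mor A T X" "f \<cdot> t = Zero A T Y"
  have X: "X \<in> Obj A" using f mor_Dom_Obj by blast
  have z: "Zero A Z X \<in> mor A Z X" using Z X zero_in_mor by (simp add: is_zero_object_def)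
  obtain k c where c: "is_cokernel A (Zero A Z X) c" and k: "is_kernel A c k" "is_kernel A f k"
    using ex by (auto simp: exact_at_def is_image_def)
  have cm: "c \<in> mor A X (Cod A c)" using cokernel_in_mor[OF c z] .
  have km: "k \<in> mor A (Dom A k) X" using kernel_in_mor[OF k(2) f] .
  obtain u where u: "u \<in> mor A T (Dom A k)" "k \<cdot> u = t" using kernel_factor[OF k(2) f km t] .
  have "Ide A X \<cdot> Zero A Z X = Zero A Z X" using ide_left[OF z] .
  then obtain r where r: "r \<in> mor A (Cod A c) X" "r \<cdot> c = Ide A X"
    using cokernel_factor[OF c z cm ide_in_mor[OF X]] by metis
  have "t = r \<cdot> (c \<cdot> t)" using r comp_assoc[OF t(1) cm r(1)] ide_left[OF t(1)] by simp
  moreover have "c \<cdot> t = Zero A T (Cod A c)"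
    using u comp_assoc[OF u(1) km cm] kernel_zero[OF k(1) cm] comp_zero_left[OF u(1)]
      mor_Cod_Obj[OF cm] by metis
  ultimately show "t = Zero A T X" using comp_zero_right[OF r(1)] mor_Dom_Obj[OF t(1)] by simp
qed

text \<open>The image of \<open>g\<close> is the kernel of the zero arrow, and the identity of
  \<open>Y\<close> factors through that kernel. An arrow \<open>t\<close> that kills
  \<open>g\<close> factors through the cokernel of \<open>g\<close>, so it kills this split image
  and is zero.\<close>

lemma exact_zero_epi:
  assumes g: "g \<in> mor A X Y" and Z: "is_zero_object A Z" and ex: "exact_at A g (Zero A Y Z)"
  shows "is_epi A g"
proof (rule epiI[OF g])
  fix T t assume t: "t \<in> mor A Y T" "t \<cdot> g = Zero A X T"
  have Y: "Y \<in> Obj A" using g mor_Cod_Obj by blast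
  have z: "Zero A Y Z \<in> mor A Y Z" using Z Y zero_in_mor by (simp add: is_zero_object_def)
  obtain k c where c: "is_cokernel A g c" and k: "is_kernel A c k" "is_kernel A (Zero A Y Z) k"
    using ex by (auto simp: exact_at_def is_image_def)
  have cm: "c \<in> mor A Y (Cod A c)" using cokernel_in_mor[OF c g] .
  have km: "k \<in> mor A (Dom A k) Y" using kernel_in_mor[OF k(1) cm] .
  obtain u where u: "u \<in> mor A (Cod A c) T" "u \<cdot> c = t" using cokernel_factor[OF c g cm t] .
  have "Zero A Y Z \<cdot> Ide A Y = Zero A Y Z" using ide_right[OF z] .
  then obtain r where r: "r \<in> mor A Y (Dom A k)" "k \<cdot> r = Ide A Y"
    using kernel_factor[OF k(2) z km ide_in_mor[OF Y]] by metis
  have "t = (t \<cdot> k) \<cdot> r" using r comp_assoc[OF r(1) km t(1)] ide_right[OF t(1)] by simp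
  moreover have "t \<cdot> k = Zero A (Dom A k) T"
    using u comp_assoc[OF km cm u(1)] kernel_zero[OF k(1) cm] comp_zero_right[OF u(1)]
      mor_Dom_Obj[OF km] by metis
  ultimately show "t = Zero A Y T" using comp_zero_left[OF r(1)] mor_Cod_Obj[OF t(1)] by simp
qed

text \<open>The definition of \<open>exact_at\<close> provides only some common kernel
  \<open>k\<close>. Any other kernel \<open>m\<close> of \<open>f\<close> factors through
  \<open>k\<close> and conversely, which makes \<open>m\<close> a kernel of \<open>g\<close> as
  well.\<close>

lemma is_kernel_cong:
  assumes k: "is_kernel A f k" "is_kernel A g k" and m: "is_kernel A f m"
    and f: "f \<in> mor A X Y" and g: "g \<in> mor A X Z"
  shows "is_kernel A g m"
proof -
  let ?K = "Dom A k" and ?M = "Dom A m"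
  have km: "k \<in> mor A ?K X" and mm: "m \<in> mor A ?M X" using kernel_in_mor k m f by blast+
  obtain u where u: "u \<in> mor A ?K ?M" "m \<cdot> u = k"
    using kernel_factor[OF m f mm km] kernel_zero[OF k(1) f] by metis
  obtain v where v: "v \<in> mor A ?M ?K" "k \<cdot> v = m"
    using kernel_factor[OF k(1) f km mm] kernel_zero[OF m f] by metis
  have gm: "g \<cdot> m = Zero A ?M Z"
    using v comp_assoc[OF v(1) km g] kernel_zero[OF k(2) g] comp_zero_left[OF v(1)]
      mor_Cod_Obj[OF g] by metis
  show ?thesis
  proof (rule is_kernelI[OF g mm gm kernel_mono[OF m]])
    fix T h assume h: "h \<in> mor A T X" "g \<cdot> h = Zero A T Z"
    obtain w where w: "w \<in> mor A T ?K" "k \<cdot> w = h" using kernel_factor[OF k(2) g km h] .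
    show "\<exists>x \<in> mor A T ?M. m \<cdot> x = h"
      using w u comp_assoc[OF w(1) u(1) mm] comp_in_mor[OF w(1) u(1)] by metis
  qed
qed

lemma short_exactD:
  assumes "short_exact A f g"
  obtains X Y Z where "f \<in> mor A X Y" "g \<in> mor A Y Z" "is_kernel A g f" "is_epi A g"
proof -
  obtain O' where O': "is_zero_object A O'" "exact_at A (Zero A O' (Dom A f)) f" "exact_at A f g"
    "exact_at A g (Zero A (Cod A g) O')"
    using assms by (auto simp: short_exact_def)
  then obtain k c where c: "is_cokernel A f c" and k: "is_kernel A c k" "is_kernel A g k"
    by (auto simp: exact_at_def is_image_def)
  have f: "f \<in> mor A (Dom A f) (Cod A f)" using c by (auto simp: is_cokernel_def mor_def)
  have g: "g \<in> mor A (Cod A f) (Cod A g)" using k O'(3)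
    by (auto simp: is_kernel_def exact_at_def mor_def)
  \<comment> \<open>A mono is the kernel of its cokernel \<open>c\<close>. Exactness in the middle
    gives \<open>c\<close> and \<open>g\<close> a common kernel, so \<open>f\<close> is also the
    kernel of \<open>g\<close>.\<close>
  have "is_mono A f" using exact_zero_mono[OF f O'(1,2)] .
  then have "is_kernel A c f" using mono_kernel_cokernel[OF f _ c] by blast
  then have "is_kernel A g f" using is_kernel_cong[OF k _ cokernel_in_mor[OF c f] g] by blast
  then show ?thesis using that[OF f g] exact_zero_epi[OF g O'(1,4)] by blast
qed

lemma short_exactI:
  assumes k: "is_kernel A e k" and e: "e \<in> mor A X Y" "is_epi A e"
  shows "short_exact A k e"
proof -
  let ?K = "Dom A k"
  obtain Z where Z: "is_zero_object A Z" using ex_zero_object by blast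
  have ZO: "Z \<in> Obj A" using Z by (simp add: is_zero_object_def)
  have km: "k \<in> mor A ?K X" using kernel_in_mor[OF k e(1)] .
  have KO: "?K \<in> Obj A" "X \<in> Obj A" "Y \<in> Obj A" using km e mor_Dom_Obj mor_Cod_Obj by blast+
  have z1: "Zero A Z ?K \<in> mor A Z ?K" and z2: "Zero A Y Z \<in> mor A Y Z"
    using zero_in_mor ZO KO by blast+
  have mono0: "is_mono A (Zero A Z ?K)"
    using monoI[OF z1] mor_to_zero_object[OF Z] by blast
  have epi0: "is_epi A (Zero A Y Z)"
    using epiI[OF z2] mor_from_zero_object[OF Z] by blast
  \<comment> \<open>Used twice below: with \<open>f\<close> the identity of \<open>?K\<close>, which
    is a cokernel of the zero arrow, and with \<open>f = k\<close>. This makes the image of the zero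
    arrow agree with the kernel of \<open>k\<close>.\<close>
  have kernel0: "is_kernel A f (Zero A Z ?K)" if f: "f \<in> mor A ?K V" "is_mono A f" for f V
  proof (rule is_kernelI[OF f(1) z1 comp_zero_right[OF f(1) ZO] mono0])
    fix T h assume h: "h \<in> mor A T ?K" "f \<cdot> h = Zero A T V"
    then have "h = Zero A Z ?K \<cdot> Zero A T Z"
      using mono_zeroD[OF f(2,1)] comp_zero_right[OF z1] mor_Dom_Obj by metis
    then show "\<exists>u \<in> mor A T Z. Zero A Z ?K \<cdot> u = h" using zero_in_mor ZO mor_Dom_Obj h by metis
  qed
  have "is_cokernel A (Zero A Z ?K) (Ide A ?K)"
    by (rule is_cokernelI[OF z1 ide_in_mor[OF KO(1)] ide_left[OF z1] ide_epi[OF KO(1)]])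
      (use ide_right in blast)
  then have "exact_at A (Zero A Z ?K) k"
    using kernel0[OF ide_in_mor[OF KO(1)] ide_mono[OF KO(1)]] kernel0[OF km kernel_mono[OF k]] z1
    by (auto simp: exact_at_def is_image_def mor_Cod)
  moreover have "exact_at A k e"
    using epi_cokernel_kernel[OF e k] k e km by (auto simp: exact_at_def is_image_def mor_Cod mor_Dom)
  moreover have "exact_at A e (Zero A Y Z)"
  proof -
    \<comment> \<open>The arrow from \<open>Y\<close> to \<open>Z\<close> is both the cokernel of
      \<open>e\<close> and the next arrow of the sequence, so the identity of \<open>Y\<close>
      serves as image and as kernel.\<close>
    have "is_cokernel A e (Zero A Y Z)"
    proof (rule is_cokernelI[OF e(1) z2 comp_zero_left[OF e(1) ZO] epi0])
      fix T h assume h: "h \<in> mor A Y T" "h \<cdot> e = Zero A X T"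
      then have "h = Zero A Z T \<cdot> Zero A Y Z"
        using epi_zeroD[OF e(2,1)] comp_zero_left[OF z2] mor_Cod_Obj by metis
      then show "\<exists>u \<in> mor A Z T. u \<cdot> Zero A Y Z = h" using zero_in_mor ZO mor_Cod_Obj h by metis
    qed
    moreover have "is_kernel A (Zero A Y Z) (Ide A Y)"
      by (rule is_kernelI[OF z2 ide_in_mor[OF KO(3)] ide_right[OF z2] ide_mono[OF KO(3)]])
        (use ide_left in blast)
    ultimately show ?thesis using e z2 by (auto simp: exact_at_def is_image_def mor_Cod mor_Dom)
  qed
  ultimately show ?thesis using Z e by (auto simp: short_exact_def mor_Cod)
qed

end


section \<open>Precovers and syzygies\<close>

text \<open>A precover need not be epic here. Where its kernel has to sit in a short exact sequence,
  \<open>is_epi\<close> is assumed separately.\<close>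

definition is_precover :: "('o, 'm) cat \<Rightarrow> 'o set \<Rightarrow> 'o \<Rightarrow> 'o \<Rightarrow> 'm \<Rightarrow> bool" where
  "is_precover A W V N e \<longleftrightarrow> V \<in> W \<and> e \<in> mor A V N \<and>
     (\<forall>X \<in> W. \<forall>h \<in> mor A X N. \<exists>u \<in> mor A X V. e \<cdot>\<^bsub>A\<^esub> u = h)"

lemma is_precoverD:
  assumes "is_precover A W V N e"
  shows "V \<in> W" "e \<in> mor A V N"
  using assms by (auto simp: is_precover_def)

lemma is_precover_lift:
  assumes "is_precover A W V N e" "X \<in> W" "h \<in> mor A X N"
  obtains u where "u \<in> mor A X V" "e \<cdot>\<^bsub>A\<^esub> u = h"
  using assms by (auto simp: is_precover_def)

context abelian_category
begin

lemma F_exact_hom_functor_iff: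
  assumes f: "f \<in> mor A X Y" and g: "g \<in> mor A Y Z"
  shows "F_exact A (hom_functor A T) f g \<longleftrightarrow>
    Comp A f ` mor A T X = {h \<in> mor A T Y. g \<cdot> h = Zero A T Z}"
  by (simp add: F_exact_def hom_functor_def hom_group_def kernel_def
      mor_Dom[OF f] mor_Dom[OF g] mor_Cod[OF g])

lemma F_surjective_hom_functor_iff:
  assumes g: "g \<in> mor A Y Z"
  shows "F_surjective A (hom_functor A T) g \<longleftrightarrow> Comp A g ` mor A T Y = mor A T Z"
  by (simp add: F_surjective_def hom_functor_def hom_group_def mor_Dom[OF g] mor_Cod[OF g])

lemma hom_exact_short_lift:
  assumes "hom_exact_short A W f g" and g: "g \<in> mor A Y Z" and "X \<in> W" "h \<in> mor A X Z"
  obtains u where "u \<in> mor A X Y" "g \<cdot> u = h"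
proof -
  have "h \<in> Comp A g ` mor A X Y"
    using assms F_surjective_hom_functor_iff[OF g] by (auto simp: hom_exact_short_def)
  then show ?thesis using that by blast
qed

text \<open>Exactness on the left holds because Hom out of any object preserves kernels.
  Surjectivity is the lifting property of the precover.\<close>

lemma precover_hom_exact_short:
  assumes e: "is_precover A W V N e" and k: "is_kernel A e k"
  shows "hom_exact_short A W k e"
  unfolding hom_exact_short_def
proof (intro ballI conjI)
  fix X assume X: "X \<in> W"
  have em: "e \<in> mor A V N" using is_precoverD(2)[OF e] .
  have km: "k \<in> mor A (Dom A k) V" using kernel_in_mor[OF k em] .
  show "F_injective A (hom_functor A X) k"
    using monoD[OF kernel_mono[OF k] km]
    by (auto simp: F_injective_def hom_functor_def hom_group_def intro!: inj_onI)
  show "F_exact A (hom_functor A X) k e"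
    unfolding F_exact_hom_functor_iff[OF km em]
  proof (intro equalityI subsetI)
    fix h assume "h \<in> Comp A k ` mor A X (Dom A k)"
    then obtain u where u: "u \<in> mor A X (Dom A k)" "h = k \<cdot> u" by blast
    then have "e \<cdot> h = Zero A X N"
      using comp_assoc[OF u(1) km em] kernel_zero[OF k em] comp_zero_left[OF u(1)]
        mor_Cod_Obj[OF em] by simp
    then show "h \<in> {h \<in> mor A X V. e \<cdot> h = Zero A X N}" using u comp_in_mor[OF u(1) km] by simp
  next
    fix h assume "h \<in> {h \<in> mor A X V. e \<cdot> h = Zero A X N}"
    then obtain u where "u \<in> mor A X (Dom A k)" "k \<cdot> u = h"
      using kernel_factor[OF k em km, of h X] by blast
    then show "h \<in> Comp A k ` mor A X (Dom A k)" by blast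
  qed
  have "Comp A e ` mor A X V = mor A X N"
  proof
    show "Comp A e ` mor A X V \<subseteq> mor A X N" using comp_in_mor[OF _ em] by blast
    show "mor A X N \<subseteq> Comp A e ` mor A X V"
    proof
      fix h assume "h \<in> mor A X N"
      then obtain u where "u \<in> mor A X V" "e \<cdot> u = h" using is_precover_lift[OF e X] by blast
      then show "h \<in> Comp A e ` mor A X V" by blast
    qed
  qed
  then show "F_surjective A (hom_functor A X) e"
    unfolding F_surjective_hom_functor_iff[OF em] .
qed

text \<open>Lift twice: along \<open>g\<close> because the sequence is Hom-exact, then along
  \<open>p\<close>. A precover of the middle term thus also precovers the right-hand term.\<close>

lemma precover_comp:
  assumes p: "is_precover A W V Y p" and g: "hom_exact_short A W f g" "g \<in> mor A Y Z"
  shows "is_precover A W V Z (g \<cdot> p)"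
  unfolding is_precover_def
proof (intro conjI ballI)
  have pm: "p \<in> mor A V Y" using is_precoverD(2)[OF p] .
  show "V \<in> W" using is_precoverD(1)[OF p] .
  show "g \<cdot> p \<in> mor A V Z" using comp_in_mor[OF pm g(2)] .
  fix X h assume X: "X \<in> W" and h: "h \<in> mor A X Z"
  obtain u where u: "u \<in> mor A X Y" "g \<cdot> u = h" using hom_exact_short_lift[OF g X h] .
  obtain v where v: "v \<in> mor A X V" "p \<cdot> v = u" using is_precover_lift[OF p X u(1)] .
  show "\<exists>u \<in> mor A X V. (g \<cdot> p) \<cdot> u = h" using u v comp_assoc[OF v(1) pm g(2)] by auto
qed

lemma proper_resolution_precover:
  assumes P: "proper_resolution A W N P"
  shows "is_precover A W (term_at P 0) N (aug P)"
proof -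
  have m: "aug P \<in> mor A (term_at P 0) N" "term_at P 0 \<in> W"
    using P by (auto simp: proper_resolution_def)
  have "Comp A (aug P) ` mor A X (term_at P 0) = mor A X N" if "X \<in> W" for X
    using P that F_surjective_hom_functor_iff[OF m(1)] by (auto simp: proper_resolution_def)
  then have "\<exists>u \<in> mor A X (term_at P 0). aug P \<cdot> u = h" if "X \<in> W" "h \<in> mor A X N" for X h
    using that by (metis imageE)
  then show ?thesis using m unfolding is_precover_def by simp
qed

lemma proper_resolution_epi:
  assumes P: "proper_resolution A W N P"
  shows "is_epi A (aug P)"
  using P exact_zero_epi unfolding proper_resolution_def by blast

section \<open>Syzygies as kernels of epic precovers\<close>

lemma exact_comp_zero:
  assumes "exact_at A f g" and f: "f \<in> mor A X Y" and g: "g \<in> mor A Y Z"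
  shows "g \<cdot> f = Zero A X Z"
proof -
  obtain k c where c: "is_cokernel A f c" and k: "is_kernel A c k" "is_kernel A g k"
    using assms by (auto simp: exact_at_def is_image_def)
  have cm: "c \<in> mor A Y (Cod A c)" using cokernel_in_mor[OF c f] .
  have km: "k \<in> mor A (Dom A k) Y" using kernel_in_mor[OF k(2) g] .
  obtain u where u: "u \<in> mor A X (Dom A k)" "k \<cdot> u = f"
    using kernel_factor[OF k(1) cm km f cokernel_zero[OF c f]] .
  then show ?thesis
    using comp_assoc[OF u(1) km g] kernel_zero[OF k(2) g] comp_zero_left[OF u(1)]
      mor_Cod_Obj[OF g] by simp
qed

text \<open>The arrow \<open>b\<close> induces \<open>m\<close> on the cokernel of \<open>a\<close>.
  Exactness at \<open>Y\<close> makes \<open>m\<close> mono by \<open>mono_part\<close>. Since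
  \<open>c\<close> is epi, \<open>m\<close> and \<open>b\<close> have the same cokernel, so
  exactness at \<open>V\<close> makes \<open>m\<close> a kernel of \<open>d\<close>.\<close>

lemma cokernel_kernel_of_exact:
  assumes a: "a \<in> mor A X Y" and b: "b \<in> mor A Y V" and d: "d \<in> mor A V M"
    and ab: "exact_at A a b" and bd: "exact_at A b d" and c: "is_cokernel A a c"
  obtains m where "m \<in> mor A (Cod A c) V" "is_kernel A d m"
proof -
  let ?K = "Cod A c"
  have cm: "c \<in> mor A Y ?K" using cokernel_in_mor[OF c a] .
  obtain m where m: "m \<in> mor A ?K V" "m \<cdot> c = b"
    using cokernel_factor[OF c a cm b exact_comp_zero[OF ab a b]] .
  obtain k c' where c': "is_cokernel A a c'" and k: "is_kernel A c' k" "is_kernel A b k"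
    using ab by (auto simp: exact_at_def is_image_def)
  have km: "k \<in> mor A (Dom A k) Y" using kernel_in_mor[OF k(2) b] .
  have cm': "c' \<in> mor A Y (Cod A c')" using cokernel_in_mor[OF c' a] .
  \<comment> \<open>Exactness comes with its own cokernel \<open>c'\<close> of \<open>a\<close>. The
    comparison \<open>r\<close> transfers to \<open>c\<close> that the kernel of \<open>b\<close> is
    killed.\<close>
  obtain r where r: "r \<in> mor A (Cod A c') ?K" "r \<cdot> c' = c"
    using cokernel_factor[OF c' a cm' cm cokernel_zero[OF c a]] .
  have ck: "c \<cdot> k = Zero A (Dom A k) ?K"
    using r comp_assoc[OF km cm' r(1)] kernel_zero[OF k(1) cm'] comp_zero_right[OF r(1)]
      mor_Dom_Obj[OF km] by simp
  have mono: "is_mono A m"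
    by (rule mono_part[OF b cm cokernel_epi[OF c] m(1) m(2) k(2) ck])
  obtain l q where q: "is_cokernel A b q" and l: "is_kernel A q l" "is_kernel A d l"
    using bd by (auto simp: exact_at_def is_image_def)
  have qm: "q \<in> mor A V (Cod A q)" using cokernel_in_mor[OF q b] .
  have qmk: "q \<cdot> m \<in> mor A ?K (Cod A q)" using comp_in_mor[OF m(1) qm] .
  have "(q \<cdot> m) \<cdot> c = Zero A Y (Cod A q)"
    using comp_assoc[OF cm m(1) qm] m(2) cokernel_zero[OF q b] by simp
  then have qm0: "q \<cdot> m = Zero A ?K (Cod A q)"
    using epi_zeroD[OF cokernel_epi[OF c] cm qmk] by simp
  have "is_cokernel A m q"
  proof (rule is_cokernelI[OF m(1) qm qm0 cokernel_epi[OF q]])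
    fix T h assume h: "h \<in> mor A V T" "h \<cdot> m = Zero A ?K T"
    have "h \<cdot> b = Zero A Y T"
      using comp_assoc[OF cm m(1) h(1)] m(2) h(2) comp_zero_left[OF cm] mor_Cod_Obj[OF h(1)] by simp
    then show "\<exists>u \<in> mor A (Cod A q) T. u \<cdot> q = h"
      using cokernel_factor[OF q b qm h(1)] by metis
  qed
  then have "is_kernel A q m" using mono_kernel_cokernel[OF m(1) mono] by blast
  then have "is_kernel A d m" using is_kernel_cong[OF l _ qm d] by blast
  then show ?thesis using that m(1) by blast
qed

text \<open>The epic part is the cokernel of \<open>k\<close>, and the rest is mono by
  \<open>mono_part\<close>. What matters later is that the prescribed \<open>k\<close> remains the
  kernel of the epic part.\<close>

lemma epi_mono_factorization:
  assumes d: "d \<in> mor A V M" and k: "is_kernel A d k"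
  obtains N e n where "e \<in> mor A V N" "is_epi A e" "is_kernel A e k"
    "n \<in> mor A N M" "is_mono A n" "n \<cdot> e = d"
proof -
  have km: "k \<in> mor A (Dom A k) V" using kernel_in_mor[OF k d] .
  obtain e where e: "is_cokernel A k e" using ex_cokernel km mor_Arr by blast
  have em: "e \<in> mor A V (Cod A e)" using cokernel_in_mor[OF e km] .
  obtain n where n: "n \<in> mor A (Cod A e) M" "n \<cdot> e = d"
    using cokernel_factor[OF e km em d kernel_zero[OF k d]] .
  have "is_mono A n"
    by (rule mono_part[OF d em cokernel_epi[OF e] n k cokernel_zero[OF e km]])
  moreover have "is_kernel A e k" using mono_kernel_cokernel[OF km kernel_mono[OF k] e] .
  ultimately show ?thesis using that[OF em cokernel_epi[OF e] _ n(1) _ n(2)] by blast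
qed

text \<open>Mind the index: \<open>diff P 1\<close> goes from degree 2 to degree 1, so its cokernel
  is the kernel of the augmentation.\<close>

lemma first_syzygy_kernel:
  assumes P: "proper_resolution A W N P" and c: "is_cokernel A (diff P 1) c"
  obtains m where "m \<in> mor A (Cod A c) (term_at P 0)" "is_kernel A (aug P) m"
proof -
  have "diff P 1 \<in> mor A (term_at P (Suc 1)) (term_at P 1)"
    "diff P 0 \<in> mor A (term_at P 1) (term_at P 0)" "aug P \<in> mor A (term_at P 0) N"
    "exact_at A (diff P 1) (diff P 0)" "exact_at A (diff P 0) (aug P)"
    using P by (auto simp: proper_resolution_def)
  then show ?thesis using cokernel_kernel_of_exact c that by blast
qed

text \<open>All syzygies are treated alike through this lemma. The first is the kernel of the
  augmentation. For \<open>i = Suc j\<close> the object \<open>M\<close> is the image of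
  \<open>diff P j\<close>, and its precover is the epic part of that differential.\<close>

lemma syzygy_precover:
  assumes P: "proper_resolution A W N P" and c: "is_cokernel A (diff P (Suc i)) c"
  obtains V M e m where "is_precover A W V M e" "is_epi A e"
    "m \<in> mor A (Cod A c) V" "is_kernel A e m"
proof (cases i)
  case 0
  then show ?thesis
    using first_syzygy_kernel[OF P] c proper_resolution_precover[OF P] proper_resolution_epi[OF P]
      that by (metis One_nat_def)
next
  case (Suc j)
  let ?T = "term_at P"
  have diff: "\<And>i. diff P i \<in> mor A (?T (Suc i)) (?T i)"
    and ex: "\<And>i. exact_at A (diff P (Suc i)) (diff P i)"
    and W: "\<And>i. ?T i \<in> W" using P by (auto simp: proper_resolution_def)
  \<comment> \<open>The arrow that leaves degree \<open>j\<close>: the augmentation in degree 0, a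
    differential above it. This lets one argument cover both.\<close>
  define b where "b = (case j of 0 \<Rightarrow> aug P | Suc l \<Rightarrow> diff P l)"
  define M where "M = (case j of 0 \<Rightarrow> N | Suc l \<Rightarrow> ?T l)"
  have b: "b \<in> mor A (?T j) M" "exact_at A (diff P j) b"
    and hom: "\<And>X. X \<in> W \<Longrightarrow> F_exact A (hom_functor A X) (diff P j) b"
    using P by (auto simp: proper_resolution_def b_def M_def split: nat.split)
  obtain m where m: "m \<in> mor A (Cod A c) (?T (Suc j))" "is_kernel A (diff P j) m"
    using cokernel_kernel_of_exact[OF diff diff diff ex ex] c Suc by metis
  obtain N' e n where e: "e \<in> mor A (?T (Suc j)) N'" "is_epi A e" "is_kernel A e m"
    and n: "n \<in> mor A N' (?T j)" "is_mono A n" "n \<cdot> e = diff P j"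
    using epi_mono_factorization[OF diff m(2)] .
  have bn: "b \<cdot> n \<in> mor A N' M" using comp_in_mor[OF n(1) b(1)] .
  have "(b \<cdot> n) \<cdot> e = Zero A (?T (Suc j)) M"
    using comp_assoc[OF e(1) n(1) b(1)] n(3) exact_comp_zero[OF b(2) diff b(1)] by simp
  then have bn0: "b \<cdot> n = Zero A N' M" using epi_zeroD[OF e(2,1) bn] by simp
  \<comment> \<open>Push \<open>h\<close> forward along the mono \<open>n\<close>. The result is
    killed by \<open>b\<close>, so Hom-exactness of the resolution lifts it along
    \<open>diff P j\<close>, and cancelling \<open>n\<close> turns this into a lift along
    \<open>e\<close>.\<close>
  have "\<exists>u \<in> mor A X (?T (Suc j)). e \<cdot> u = h" if X: "X \<in> W" and h: "h \<in> mor A X N'" for X h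
  proof -
    have nh: "n \<cdot> h \<in> mor A X (?T j)" using comp_in_mor[OF h n(1)] .
    have "b \<cdot> (n \<cdot> h) = Zero A X M"
      using comp_assoc[OF h n(1) b(1)] bn0 comp_zero_left[OF h] mor_Cod_Obj[OF b(1)] by simp
    then have "n \<cdot> h \<in> Comp A (diff P j) ` mor A X (?T (Suc j))"
      using hom[OF X] nh unfolding F_exact_hom_functor_iff[OF diff b(1)] by simp
    then obtain u where u: "u \<in> mor A X (?T (Suc j))" "diff P j \<cdot> u = n \<cdot> h" by auto
    then have "n \<cdot> (e \<cdot> u) = n \<cdot> h" using comp_assoc[OF u(1) e(1) n(1)] n(3) by simp
    then show ?thesis using monoD[OF n(2,1) comp_in_mor[OF u(1) e(1)] h] u by blast
  qed
  then have "is_precover A W (?T (Suc j)) N' e" using W e(1) by (auto simp: is_precover_def)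
  then show ?thesis using that e m(1) by blast
qed

end

section \<open>The stable functor as a quotient\<close>

lemma (in group) rcos_eq_iff:
  assumes H: "subgroup H G" and x: "x \<in> carrier G" and y: "y \<in> carrier G"
  shows "H #> x = H #> y \<longleftrightarrow> x \<otimes> inv y \<in> H"
proof -
  have "H #> x = H #> y \<longleftrightarrow> x \<in> H #> y"
    using rcos_self[OF x H] repr_independence[OF _ y H] by blast
  then show ?thesis using subgroup.rcos_module[OF H group_axioms y x] by simp
qed

text \<open>This evaluates the set product in \<open>ab_coker_map\<close> on a coset: the image of
  \<open>T\<close> lies in \<open>S\<close> and is absorbed by it.\<close>

lemma (in group_hom) set_mult_image_rcoset:
  assumes S: "subgroup S H" and T: "subgroup T G" and hT: "h ` T \<subseteq> S" and x: "x \<in> carrier G"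
  shows "S <#>\<^bsub>H\<^esub> h ` (T #>\<^bsub>G\<^esub> x) = S #>\<^bsub>H\<^esub> h x"
proof -
  have Tc: "T \<subseteq> carrier G" and Sc: "S \<subseteq> carrier H" using S T subgroup.subset by auto
  have "h ` (T #>\<^bsub>G\<^esub> x) = h ` T #>\<^bsub>H\<^esub> h x"
    using Tc x by (force simp: r_coset_def)
  moreover have "S <#>\<^bsub>H\<^esub> h ` T = S"
  proof
    show "S <#>\<^bsub>H\<^esub> h ` T \<subseteq> S" using hT subgroup.m_closed[OF S] by (auto simp: set_mult_def)
    show "S \<subseteq> S <#>\<^bsub>H\<^esub> h ` T"
    proof
      fix s assume s: "s \<in> S"
      then have "s = s \<otimes>\<^bsub>H\<^esub> h \<one>" using Sc by auto
      then show "s \<in> S <#>\<^bsub>H\<^esub> h ` T"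
        using s subgroup.one_closed[OF T] unfolding set_mult_def by blast
    qed
  qed
  ultimately show ?thesis
    using H.setmult_rcos_assoc[of S "h ` T" "h x"] Sc hT x by auto
qed

section \<open>Additive functors on elements\<close>

locale additive_functor_on = preadditive_category A for A :: "('o, 'm) cat" (structure) +
  fixes G :: "('o, 'm, 'g) ab_functor"
  assumes additive: "additive_functor A G"
begin

lemma Fo_comm_group: "X \<in> Obj A \<Longrightarrow> comm_group (Fo G X)"
  using additive by (simp add: additive_functor_def)

lemma Fm_hom: "f \<in> mor A X Y \<Longrightarrow> Fm G f \<in> hom (Fo G X) (Fo G Y)"
  using additive by (auto simp: additive_functor_def mor_def)

lemma Fm_group_hom:
  assumes "f \<in> mor A X Y"
  shows "group_hom (Fo G X) (Fo G Y) (Fm G f)"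
  using Fo_comm_group[OF mor_Dom_Obj[OF assms]] Fo_comm_group[OF mor_Cod_Obj[OF assms]]
    Fm_hom[OF assms]
  by (simp add: group_hom_def group_hom_axioms_def comm_group_def)

lemma Fm_closed: "f \<in> mor A X Y \<Longrightarrow> x \<in> carrier (Fo G X) \<Longrightarrow> Fm G f x \<in> carrier (Fo G Y)"
  using Fm_hom by (auto simp: hom_def)

lemma Fm_ide: "X \<in> Obj A \<Longrightarrow> x \<in> carrier (Fo G X) \<Longrightarrow> Fm G (Ide A X) x = x"
  using additive by (simp add: additive_functor_def)

lemma Fm_comp:
  "\<lbrakk>f \<in> mor A X Y; g \<in> mor A Y Z; x \<in> carrier (Fo G X)\<rbrakk> \<Longrightarrow> Fm G (g \<cdot> f) x = Fm G g (Fm G f x)"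
  using additive unfolding additive_functor_def by blast

lemma Fm_add:
  "\<lbrakk>f \<in> mor A X Y; g \<in> mor A X Y; x \<in> carrier (Fo G X)\<rbrakk>
    \<Longrightarrow> Fm G (Add A f g) x = Fm G f x \<otimes>\<^bsub>Fo G Y\<^esub> Fm G g x"
  using additive unfolding additive_functor_def by blast

lemma Fm_zero:
  assumes X: "X \<in> Obj A" and Y: "Y \<in> Obj A" and x: "x \<in> carrier (Fo G X)"
  shows "Fm G (Zero A X Y) x = \<one>\<^bsub>Fo G Y\<^esub>"
proof -
  interpret Y: comm_group "Fo G Y" using Fo_comm_group[OF Y] .
  have z: "Zero A X Y \<in> mor A X Y" using zero_in_mor[OF X Y] .
  have "Fm G (Zero A X Y) x \<otimes>\<^bsub>Fo G Y\<^esub> Fm G (Zero A X Y) x = Fm G (Zero A X Y) x"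
    using Fm_add[OF z z x] add_zero_right[OF z] by simp
  then show ?thesis using Fm_closed[OF z x] Y.l_cancel_one by simp
qed

end

text \<open>This is the image of \<open>rho\<close> at \<open>N\<close>, as \<open>rho_image\<close>
  shows, written without the quotient that defines \<open>L0\<close>.\<close>

definition precover_image ::
  "('o \<Rightarrow> ('o, 'm) resolution) \<Rightarrow> ('o, 'm, 'g) ab_functor \<Rightarrow> 'o \<Rightarrow> 'g set" where
  "precover_image P G N = Fm G (aug (P N)) ` carrier (Fo G (term_at (P N) 0))"

section \<open>The subgroup divided out by the stable functor\<close>

locale stable_functor_data = abelian_category A + additive_functor_on A G
  for A :: "('o, 'm) cat" (structure) and G :: "('o, 'm, 'g) ab_functor" +
  fixes W :: "'o set" and P :: "'o \<Rightarrow> ('o, 'm) resolution"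
  assumes W_Obj: "W \<subseteq> Obj A"
    and proper: "N \<in> Obj A \<Longrightarrow> proper_resolution A W N (P N)"
begin

abbreviation T where "T \<equiv> precover_image P G"
abbreviation S where "S \<equiv> stable_functor A P G"

lemma T_subgroup:
  assumes N: "N \<in> Obj A"
  shows "subgroup (T N) (Fo G N)"
proof -
  have "aug (P N) \<in> mor A (term_at (P N) 0) N"
    using is_precoverD(2)[OF proper_resolution_precover[OF proper[OF N]]] .
  then show ?thesis unfolding precover_image_def
    using group_hom.img_is_subgroup Fm_group_hom by blast
qed

lemma T_subset: "N \<in> Obj A \<Longrightarrow> x \<in> T N \<Longrightarrow> x \<in> carrier (Fo G N)"
  using subgroup.subset[OF T_subgroup] by blast

text \<open>Arrows from \<open>W\<close> factor through the augmentation. Hence \<open>T N\<close>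
  is the union of the images of all such arrows under \<open>G\<close>, and it does not depend on
  the resolution.\<close>

lemma T_memI:
  assumes X: "X \<in> W" and f: "f \<in> mor A X N" and x: "x \<in> carrier (Fo G X)"
  shows "Fm G f x \<in> T N"
proof -
  have p: "is_precover A W (term_at (P N) 0) N (aug (P N))"
    using proper_resolution_precover proper mor_Cod_Obj[OF f] by blast
  obtain u where u: "u \<in> mor A X (term_at (P N) 0)" "aug (P N) \<cdot> u = f"
    using is_precover_lift[OF p X f] .
  then have "Fm G f x = Fm G (aug (P N)) (Fm G u x)"
    using Fm_comp[OF u(1) is_precoverD(2)[OF p] x] by simp
  then show ?thesis unfolding precover_image_def using Fm_closed[OF u(1) x] by blast
qed

lemma T_memE:
  assumes "N \<in> Obj A" "y \<in> T N"
  obtains w where "w \<in> carrier (Fo G (term_at (P N) 0))" "y = Fm G (aug (P N)) w"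
  using assms by (auto simp: precover_image_def)

lemma T_functorial:
  assumes g: "g \<in> mor A N M" and y: "y \<in> T N"
  shows "Fm G g y \<in> T M"
proof -
  have p: "is_precover A W (term_at (P N) 0) N (aug (P N))"
    using proper_resolution_precover proper mor_Dom_Obj[OF g] by blast
  note pm = is_precoverD[OF p]
  obtain w where w: "w \<in> carrier (Fo G (term_at (P N) 0))" "y = Fm G (aug (P N)) w"
    using T_memE[OF mor_Dom_Obj[OF g] y] .
  then show ?thesis
    using T_memI[OF pm(1) comp_in_mor[OF pm(2) g] w(1)] Fm_comp[OF pm(2) g w(1)] by simp
qed

text \<open>The identity of \<open>V\<close> is itself an arrow from \<open>W\<close>, so the stable
  functor vanishes on \<open>W\<close>.\<close>

lemma T_of_W:
  assumes V: "V \<in> W"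
  shows "T V = carrier (Fo G V)"
proof -
  have O: "V \<in> Obj A" using V W_Obj by blast
  have "x \<in> T V" if "x \<in> carrier (Fo G V)" for x
    using T_memI[OF V ide_in_mor[OF O] that] Fm_ide[OF O that] by simp
  then show ?thesis using T_subset[OF O] by blast
qed

text \<open>Elements of \<open>L0\<close> are cosets of the image of \<open>diff (P N) 0\<close>
  under \<open>G\<close>. The augmentation kills that image, so it takes a single value on each
  coset, and \<open>the_elem\<close> returns this value.\<close>

lemma rho_image:
  assumes N: "N \<in> Obj A"
  shows "rho P G N ` carrier (Fo (L0 A P G) N) = T N"
proof -
  let ?P0 = "term_at (P N) 0" and ?P1 = "term_at (P N) 1"
  let ?H = "Fm G (diff (P N) 0) ` carrier (Fo G ?P1)" and ?a = "Fm G (aug (P N))"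
  have d: "diff (P N) 0 \<in> mor A ?P1 ?P0" and a: "aug (P N) \<in> mor A ?P0 N"
    and ex: "exact_at A (diff (P N) 0) (aug (P N))"
    using proper[OF N] by (auto simp: proper_resolution_def)
  interpret group_hom "Fo G ?P0" "Fo G N" ?a using Fm_group_hom[OF a] .
  have H: "subgroup ?H (Fo G ?P0)" using group_hom.img_is_subgroup[OF Fm_group_hom[OF d]] .
  have "?a h = \<one>\<^bsub>Fo G N\<^esub>" if "h \<in> ?H" for h
    using that Fm_comp[OF d a] exact_comp_zero[OF ex d a] Fm_zero[OF mor_Dom_Obj[OF d] N] by auto
  then have "?a y = ?a x" if "x \<in> carrier (Fo G ?P0)" "y \<in> ?H #>\<^bsub>Fo G ?P0\<^esub> x" for x y
    using that subgroup.subset[OF H] by (fastforce simp: r_coset_def)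
  then have "?a ` (?H #>\<^bsub>Fo G ?P0\<^esub> x) = {?a x}" if "x \<in> carrier (Fo G ?P0)" for x
    using that G.rcos_self[OF that H] by blast
  then have "rho P G N (?H #>\<^bsub>Fo G ?P0\<^esub> x) = ?a x" if "x \<in> carrier (Fo G ?P0)" for x
    using that by (simp add: rho_def)
  then show ?thesis
    by (simp add: L0_def ab_coker_def carrier_FactGroup image_image precover_image_def
        cong: image_cong_simp)
qed

lemma stable_Fo: "N \<in> Obj A \<Longrightarrow> Fo S N = Fo G N Mod T N"
  by (simp add: stable_functor_def ab_coker_def rho_image)

lemma stable_carrier:
  "N \<in> Obj A \<Longrightarrow> carrier (Fo S N) = (\<lambda>x. T N #>\<^bsub>Fo G N\<^esub> x) ` carrier (Fo G N)"
  by (simp add: stable_Fo carrier_FactGroup)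

lemma stable_Fm:
  assumes g: "g \<in> mor A N M" and x: "x \<in> carrier (Fo G N)"
  shows "Fm S g (T N #>\<^bsub>Fo G N\<^esub> x) = T M #>\<^bsub>Fo G M\<^esub> Fm G g x"
proof -
  have N: "N \<in> Obj A" and M: "M \<in> Obj A" using g mor_Dom_Obj mor_Cod_Obj by blast+
  have "Fm S g C = T M <#>\<^bsub>Fo G M\<^esub> Fm G g ` C" for C
    by (simp add: stable_functor_def ab_coker_map_def mor_Cod[OF g] rho_image[OF M])
  then show ?thesis
    using group_hom.set_mult_image_rcoset[OF Fm_group_hom[OF g] T_subgroup[OF M] T_subgroup[OF N] _ x]
      T_functorial[OF g] by auto
qed

lemma stable_rcos_eq_iff:
  assumes "N \<in> Obj A" "x \<in> carrier (Fo G N)" "y \<in> carrier (Fo G N)"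
  shows "T N #>\<^bsub>Fo G N\<^esub> x = T N #>\<^bsub>Fo G N\<^esub> y \<longleftrightarrow> x \<otimes>\<^bsub>Fo G N\<^esub> inv\<^bsub>Fo G N\<^esub> y \<in> T N"
  using group.rcos_eq_iff T_subgroup Fo_comm_group assms by (metis comm_group.axioms(2))

lemma stable_rcos_one_iff:
  assumes N: "N \<in> Obj A" and x: "x \<in> carrier (Fo G N)"
  shows "T N #>\<^bsub>Fo G N\<^esub> x = \<one>\<^bsub>Fo S N\<^esub> \<longleftrightarrow> x \<in> T N"
  using group.coset_join1[OF _ _ x T_subgroup[OF N]] group.coset_join2[OF _ x T_subgroup[OF N]]
    Fo_comm_group[OF N] by (auto simp: stable_Fo[OF N] comm_group_def)

lemma stable_mult:
  assumes N: "N \<in> Obj A" and x: "x \<in> carrier (Fo G N)" "y \<in> carrier (Fo G N)"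
  shows "(T N #>\<^bsub>Fo G N\<^esub> x) \<otimes>\<^bsub>Fo S N\<^esub> (T N #>\<^bsub>Fo G N\<^esub> y) = T N #>\<^bsub>Fo G N\<^esub> (x \<otimes>\<^bsub>Fo G N\<^esub> y)"
  using normal.rcos_sum[OF comm_group.subgroup_imp_normal[OF Fo_comm_group T_subgroup] x] N
  by (simp add: stable_Fo)

lemma stable_additive: "additive_functor A S"
  unfolding additive_functor_def
proof (intro conjI ballI allI)
  fix X assume X: "X \<in> Obj A"
  show "comm_group (Fo S X)"
    using comm_group.abelian_FactGroup[OF Fo_comm_group T_subgroup] X by (simp add: stable_Fo)
  fix x assume "x \<in> carrier (Fo S X)"
  then show "Fm S (Ide A X) x = x"
    using X stable_Fm[OF ide_in_mor[OF X]] Fm_ide by (auto simp: stable_carrier)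
next
  fix f assume "f \<in> Arr A"
  then have f: "f \<in> mor A (Dom A f) (Cod A f)" by (rule Arr_mor)
  interpret group_hom "Fo G (Dom A f)" "Fo G (Cod A f)" "Fm G f" using Fm_group_hom[OF f] .
  note O = mor_Dom_Obj[OF f] mor_Cod_Obj[OF f]
  show "Fm S f \<in> hom (Fo S (Dom A f)) (Fo S (Cod A f))"
    by (rule homI) (auto simp: stable_carrier O stable_Fm[OF f] stable_mult)
next
  fix X Y Z f g x assume f: "f \<in> mor A X Y" and g: "g \<in> mor A Y Z" and "x \<in> carrier (Fo S X)"
  then obtain y where y: "y \<in> carrier (Fo G X)" "x = T X #>\<^bsub>Fo G X\<^esub> y"
    using stable_carrier[OF mor_Dom_Obj[OF f]] by auto
  show "Fm S (g \<cdot> f) x = Fm S g (Fm S f x)"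
    using y stable_Fm[OF f] stable_Fm[OF g] stable_Fm[OF comp_in_mor[OF f g]] Fm_closed[OF f]
      Fm_comp[OF f g] by simp
next
  fix X Y f g x assume f: "f \<in> mor A X Y" and g: "g \<in> mor A X Y" and "x \<in> carrier (Fo S X)"
  then obtain y where y: "y \<in> carrier (Fo G X)" "x = T X #>\<^bsub>Fo G X\<^esub> y"
    using stable_carrier[OF mor_Dom_Obj[OF f]] by auto
  show "Fm S (Add A f g) x = Fm S f x \<otimes>\<^bsub>Fo S Y\<^esub> Fm S g x"
    using y stable_Fm[OF f] stable_Fm[OF g] stable_Fm[OF add_in_mor[OF f g]] Fm_closed[OF f]
      Fm_closed[OF g] Fm_add[OF f g] stable_mult[OF mor_Cod_Obj[OF f]] by simp
qed

lemma stable_trivial_iff: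
  assumes N: "N \<in> Obj A"
  shows "trivial_group (Fo S N) \<longleftrightarrow> T N = carrier (Fo G N)"
proof -
  have gr: "group (Fo S N)" using stable_additive N by (simp add: additive_functor_def comm_group_def)
  have "trivial_group (Fo S N) \<longleftrightarrow> (\<forall>x \<in> carrier (Fo G N). T N #>\<^bsub>Fo G N\<^esub> x = \<one>\<^bsub>Fo S N\<^esub>)"
    using group.trivial_group_subset[OF gr] stable_carrier[OF N] by auto
  then show ?thesis using stable_rcos_one_iff[OF N] T_subset[OF N] by blast
qed

section \<open>Injectivity and exactness of the stable functor on representatives\<close>

lemma stable_injectiveI:
  assumes f: "f \<in> mor A X Y"
    and inj: "\<And>x. x \<in> carrier (Fo G X) \<Longrightarrow> Fm G f x \<in> T Y \<Longrightarrow> x \<in> T X"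
  shows "F_injective A S f"
  unfolding F_injective_def mor_Dom[OF f]
proof (rule inj_onI)
  note O = mor_Dom_Obj[OF f] mor_Cod_Obj[OF f]
  interpret group_hom "Fo G X" "Fo G Y" "Fm G f" using Fm_group_hom[OF f] .
  fix a b assume "a \<in> carrier (Fo S X)" "b \<in> carrier (Fo S X)" and eq: "Fm S f a = Fm S f b"
  then obtain x y where x: "x \<in> carrier (Fo G X)" "a = T X #>\<^bsub>Fo G X\<^esub> x"
    and y: "y \<in> carrier (Fo G X)" "b = T X #>\<^bsub>Fo G X\<^esub> y"
    using stable_carrier[OF O(1)] by auto
  \<comment> \<open>Cosets agree exactly if the quotient of their representatives lies in
    \<open>T\<close>, so the hypothesis is applied to that quotient.\<close>
  have "Fm G f (x \<otimes>\<^bsub>Fo G X\<^esub> inv\<^bsub>Fo G X\<^esub> y) \<in> T Y"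
    using eq x y stable_Fm[OF f] stable_rcos_eq_iff[OF O(2)] by simp
  then show "a = b" using inj x y stable_rcos_eq_iff[OF O(1)] by simp
qed

lemma stable_injectiveD:
  assumes f: "f \<in> mor A X Y" and inj: "F_injective A S f"
    and x: "x \<in> carrier (Fo G X)" "Fm G f x \<in> T Y"
  shows "x \<in> T X"
proof -
  note O = mor_Dom_Obj[OF f] mor_Cod_Obj[OF f]
  interpret group_hom "Fo G X" "Fo G Y" "Fm G f" using Fm_group_hom[OF f] .
  have "T Y #>\<^bsub>Fo G Y\<^esub> Fm G f x = T Y #>\<^bsub>Fo G Y\<^esub> Fm G f \<one>\<^bsub>Fo G X\<^esub>"
    using stable_rcos_eq_iff[OF O(2)] x by simp
  then have "T X #>\<^bsub>Fo G X\<^esub> x = T X #>\<^bsub>Fo G X\<^esub> \<one>\<^bsub>Fo G X\<^esub>"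
    using inj_onD[OF inj[unfolded F_injective_def mor_Dom[OF f]]] x(1) stable_Fm[OF f]
      stable_carrier[OF O(1)] by simp
  then show ?thesis using stable_rcos_eq_iff[OF O(1)] x by simp
qed

text \<open>An element of the stable kernel has a representative that \<open>g\<close> sends into
  \<open>T Z\<close>, so it suffices to lift this representative modulo \<open>T Y\<close>.\<close>

lemma stable_exactI:
  assumes f: "f \<in> mor A X Y" and g: "g \<in> mor A Y Z" and gf: "g \<cdot> f = Zero A X Z"
    and ex: "\<And>y. y \<in> carrier (Fo G Y) \<Longrightarrow> Fm G g y \<in> T Z \<Longrightarrow>
      \<exists>x \<in> carrier (Fo G X). y \<otimes>\<^bsub>Fo G Y\<^esub> inv\<^bsub>Fo G Y\<^esub> Fm G f x \<in> T Y"
  shows "F_exact A S f g"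
  unfolding F_exact_def mor_Dom[OF f] mor_Dom[OF g] mor_Cod[OF g]
proof (intro equalityI subsetI)
  note O = mor_Dom_Obj[OF f] mor_Dom_Obj[OF g] mor_Cod_Obj[OF g]
  fix c assume "c \<in> Fm S f ` carrier (Fo S X)"
  then obtain x where x: "x \<in> carrier (Fo G X)" "c = T Y #>\<^bsub>Fo G Y\<^esub> Fm G f x"
    using stable_carrier[OF O(1)] stable_Fm[OF f] by auto
  have "Fm G g (Fm G f x) = \<one>\<^bsub>Fo G Z\<^esub>"
    using Fm_comp[OF f g x(1)] gf Fm_zero[OF O(1,3) x(1)] by simp
  then have "Fm G g (Fm G f x) \<in> T Z" using subgroup.one_closed[OF T_subgroup[OF O(3)]] by simp
  then show "c \<in> kernel (Fo S Y) (Fo S Z) (Fm S g)"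
    using x Fm_closed[OF f x(1)] Fm_closed[OF g] stable_Fm[OF g] stable_carrier[OF O(2)]
      stable_rcos_one_iff[OF O(3)] by (simp add: kernel_def)
next
  note O = mor_Dom_Obj[OF f] mor_Dom_Obj[OF g] mor_Cod_Obj[OF g]
  fix c assume "c \<in> kernel (Fo S Y) (Fo S Z) (Fm S g)"
  then obtain y where y: "y \<in> carrier (Fo G Y)" "c = T Y #>\<^bsub>Fo G Y\<^esub> y" "Fm S g c = \<one>\<^bsub>Fo S Z\<^esub>"
    using stable_carrier[OF O(2)] by (auto simp: kernel_def)
  then have "Fm G g y \<in> T Z"
    using stable_Fm[OF g] stable_rcos_one_iff[OF O(3)] Fm_closed[OF g] by simp
  then obtain x where x: "x \<in> carrier (Fo G X)" "y \<otimes>\<^bsub>Fo G Y\<^esub> inv\<^bsub>Fo G Y\<^esub> Fm G f x \<in> T Y"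
    using ex y(1) by blast
  then have "c = Fm S f (T X #>\<^bsub>Fo G X\<^esub> x)"
    using y stable_Fm[OF f] stable_rcos_eq_iff[OF O(2)] Fm_closed[OF f] by simp
  then show "c \<in> Fm S f ` carrier (Fo S X)" using x stable_carrier[OF O(1)] by simp
qed

text \<open>
  The comparison maps \<open>u\<close>, \<open>v\<close> between two precovers of \<open>N\<close> induce maps \<open>u'\<close>, \<open>v'\<close> between the
  kernels, and \<open>1 - v \<cdot> u = k \<cdot> h\<close> restricts to \<open>1 - v' \<cdot> u' = h \<cdot> k\<close>, which factors through \<open>V\<close>.
\<close>

lemma kernel_of_precover_unique:
  assumes e: "is_precover A W V N e" and k: "is_kernel A e k"
    and e0: "is_precover A W V0 N e0" and k0: "is_kernel A e0 k0"
    and triv: "T (Dom A k0) = carrier (Fo G (Dom A k0))"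
  shows "T (Dom A k) = carrier (Fo G (Dom A k))"
proof
  let ?K = "Dom A k" and ?L = "Dom A k0"
  note em = is_precoverD[OF e] and em0 = is_precoverD[OF e0]
  have km: "k \<in> mor A ?K V" using kernel_in_mor[OF k em(2)] .
  have km0: "k0 \<in> mor A ?L V0" using kernel_in_mor[OF k0 em0(2)] .
  note O = mor_Dom_Obj[OF km] mor_Cod_Obj[OF km]
  have N: "N \<in> Obj A" using em mor_Cod_Obj by blast
  obtain u where u: "u \<in> mor A V V0" "e0 \<cdot> u = e" using is_precover_lift[OF e0 em] .
  obtain v where v: "v \<in> mor A V0 V" "e \<cdot> v = e0" using is_precover_lift[OF e em0] .
  have "e0 \<cdot> (u \<cdot> k) = Zero A ?K N"
    using comp_assoc[OF km u(1) em0(2)] u(2) kernel_zero[OF k em(2)] by simp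
  then obtain u' where u': "u' \<in> mor A ?K ?L" "k0 \<cdot> u' = u \<cdot> k"
    using kernel_factor[OF k0 em0(2) km0 comp_in_mor[OF km u(1)]] by blast
  have "e \<cdot> (v \<cdot> k0) = Zero A ?L N"
    using comp_assoc[OF km0 v(1) em(2)] v(2) kernel_zero[OF k0 em0(2)] by simp
  then obtain v' where v': "v' \<in> mor A ?L ?K" "k \<cdot> v' = v \<cdot> k0"
    using kernel_factor[OF k em(2) km comp_in_mor[OF km0 v(1)]] by blast
  have vu: "v \<cdot> u \<in> mor A V V" using comp_in_mor[OF u(1) v(1)] .
  obtain d where d: "d \<in> mor A V V" "Ide A V = Add A (v \<cdot> u) d"
    using ex_difference[OF ide_in_mor[OF O(2)] vu] .
  have "e \<cdot> Add A (v \<cdot> u) d = e \<cdot> (v \<cdot> u)"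
    using d(2) ide_right[OF em(2)] comp_assoc[OF u(1) v(1) em(2)] v(2) u(2) by simp
  then have "e \<cdot> d = Zero A V N" using difference_in_kernel[OF vu d(1) em(2)] by simp
  then obtain h where h: "h \<in> mor A V ?K" "k \<cdot> h = d"
    using kernel_factor[OF k em(2) km d(1)] by blast
  have vu': "v' \<cdot> u' \<in> mor A ?K ?K" using comp_in_mor[OF u'(1) v'(1)] .
  have hk: "h \<cdot> k \<in> mor A ?K ?K" using comp_in_mor[OF km h(1)] .
  have "k \<cdot> (v' \<cdot> u') = (v \<cdot> u) \<cdot> k"
    using comp_assoc[OF u'(1) v'(1) km] v'(2) comp_assoc[OF u'(1) km0 v(1)] u'(2)
      comp_assoc[OF km u(1) v(1)] by simp
  moreover have "k \<cdot> (h \<cdot> k) = d \<cdot> k" using comp_assoc[OF km h(1) km] h(2) by simp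
  ultimately have "k \<cdot> Add A (v' \<cdot> u') (h \<cdot> k) = Add A ((v \<cdot> u) \<cdot> k) (d \<cdot> k)"
    using comp_add_right[OF vu' hk km] by simp
  also have "\<dots> = k \<cdot> Ide A ?K"
    using comp_add_left[OF km vu d(1)] d(2) ide_left[OF km] ide_right[OF km] by simp
  finally have id: "Add A (v' \<cdot> u') (h \<cdot> k) = Ide A ?K"
    by (rule monoD[OF kernel_mono[OF k] km add_in_mor[OF vu' hk] ide_in_mor[OF O(1)]])
  show "carrier (Fo G ?K) \<subseteq> T ?K"
  proof
    fix x assume x: "x \<in> carrier (Fo G ?K)"
    \<comment> \<open>The summand \<open>v' \<cdot> u'\<close> passes through \<open>?L\<close>,
      where \<open>triv\<close> puts every element into \<open>T\<close>.\<close>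
    have "Fm G u' x \<in> T ?L" using triv Fm_closed[OF u'(1) x] by simp
    then have "Fm G (v' \<cdot> u') x \<in> T ?K"
      using T_functorial[OF v'(1)] Fm_comp[OF u'(1) v'(1) x] by simp
    moreover have "Fm G (h \<cdot> k) x \<in> T ?K"
      using T_memI[OF em(1) h(1) Fm_closed[OF km x]] Fm_comp[OF km h(1) x] by simp
    ultimately have "Fm G (Add A (v' \<cdot> u') (h \<cdot> k)) x \<in> T ?K"
      using Fm_add[OF vu' hk x] subgroup.m_closed[OF T_subgroup[OF O(1)]] by simp
    then show "x \<in> T ?K" using id Fm_ide[OF O(1) x] by simp
  qed
  show "T ?K \<subseteq> carrier (Fo G ?K)" using T_subset[OF O(1)] by blast
qed

section \<open>Left exactness and vanishing on kernels of precovers\<close>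

lemma precover_kernel_trivial_of_left_exact:
  assumes S: "left_hom_exact A W S" and e: "is_precover A W V N e" "is_epi A e"
    and k: "is_kernel A e k"
  shows "T (Dom A k) = carrier (Fo G (Dom A k))"
proof -
  note em = is_precoverD[OF e(1)]
  have km: "k \<in> mor A (Dom A k) V" using kernel_in_mor[OF k em(2)] .
  \<comment> \<open>The sequence formed by \<open>k\<close> and \<open>e\<close> is short exact and
    Hom-exact, so left exactness of \<open>S\<close> applies to it.\<close>
  have "F_injective A S k"
    using S short_exactI[OF k em(2) e(2)] precover_hom_exact_short[OF e(1) k]
    by (auto simp: left_hom_exact_def)
  then have "x \<in> T (Dom A k)" if "x \<in> carrier (Fo G (Dom A k))" for x
    using stable_injectiveD[OF km _ that] Fm_closed[OF km that] T_of_W[OF em(1)] by simp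
  then show ?thesis using T_subset[OF mor_Dom_Obj[OF km]] by blast
qed

lemma stable_left_exact:
  assumes G: "left_hom_exact A W G"
    and triv: "\<And>V N e k. \<lbrakk>is_precover A W V N e; is_epi A e; is_kernel A e k\<rbrakk>
      \<Longrightarrow> T (Dom A k) = carrier (Fo G (Dom A k))"
  shows "left_hom_exact A W S"
  unfolding left_hom_exact_def
proof (intro conjI allI impI)
  show "additive_functor A S" by (rule stable_additive)
  fix f g assume "short_exact A f g \<and> hom_exact_short A W f g"
  then have se: "short_exact A f g" and he: "hom_exact_short A W f g" by auto
  obtain X Y Z where f: "f \<in> mor A X Y" and g: "g \<in> mor A Y Z"
    and ker: "is_kernel A g f" and epi: "is_epi A g"
    using short_exactD[OF se] .
  note O = mor_Dom_Obj[OF f] mor_Cod_Obj[OF f] mor_Cod_Obj[OF g]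
  have gf: "g \<cdot> f = Zero A X Z" using kernel_zero[OF ker g] mor_Dom[OF f] by simp
  have Gf: "F_injective A G f" and Gfg: "F_exact A G f g"
    using G se he by (auto simp: left_hom_exact_def)
  show "F_injective A S f"
  proof (rule stable_injectiveI[OF f])
    fix x assume x: "x \<in> carrier (Fo G X)" "Fm G f x \<in> T Y"
    let ?V = "term_at (P Y) 0" and ?p = "aug (P Y)"
    have p: "is_precover A W ?V Y ?p" "is_epi A ?p"
      using proper_resolution_precover proper_resolution_epi proper[OF O(2)] by auto
    note pm = is_precoverD[OF p(1)]
    obtain w where w: "w \<in> carrier (Fo G ?V)" "Fm G f x = Fm G ?p w" using T_memE[OF O(2) x(2)] .
    have e: "is_precover A W ?V Z (g \<cdot> ?p)" using precover_comp[OF p(1) he g] .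
    note em = is_precoverD(2)[OF e]
    have ee: "is_epi A (g \<cdot> ?p)" using epi_comp[OF pm(2) p(2) g epi] .
    obtain k where k: "is_kernel A (g \<cdot> ?p) k" using ex_kernel mor_Arr[OF em] by blast
    let ?K = "Dom A k"
    have km: "k \<in> mor A ?K ?V" using kernel_in_mor[OF k em] .
    have "F_exact A G k (g \<cdot> ?p)"
      using G short_exactI[OF k em ee] precover_hom_exact_short[OF e k]
      by (auto simp: left_hom_exact_def)
    \<comment> \<open>In \<open>G\<close> of \<open>Z\<close> the element \<open>w\<close> has the
      same image as \<open>x\<close>, which is trivial because \<open>g \<cdot> f\<close> is
      zero.\<close>
    moreover have "Fm G (g \<cdot> ?p) w = \<one>\<^bsub>Fo G Z\<^esub>"
      using Fm_comp[OF pm(2) g w(1)] w(2)[symmetric] Fm_comp[OF f g x(1)] gf Fm_zero[OF O(1,3) x(1)]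
      by simp
    ultimately have "w \<in> Fm G k ` carrier (Fo G ?K)"
      using w(1) unfolding F_exact_def mor_Dom[OF em] mor_Cod[OF em] kernel_def by simp
    then obtain z where z: "z \<in> carrier (Fo G ?K)" "w = Fm G k z" by blast
    \<comment> \<open>As \<open>f\<close> is the kernel of \<open>g\<close>, the arrow from
      \<open>?K\<close> to \<open>Y\<close> factors through \<open>X\<close>. The factor
      \<open>l\<close> transports stable vanishing from \<open>?K\<close> to \<open>x\<close>:
      injectivity of \<open>G\<close> on \<open>f\<close> identifies \<open>x\<close> with the image
      of \<open>z\<close>.\<close>
    have "g \<cdot> (?p \<cdot> k) = Zero A ?K Z"
      using comp_assoc[OF km pm(2) g] kernel_zero[OF k em] by simp
    then obtain l where l: "l \<in> mor A ?K X" "f \<cdot> l = ?p \<cdot> k"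
      using kernel_factor[OF ker g f comp_in_mor[OF km pm(2)]] by blast
    have "Fm G f (Fm G l z) = Fm G f x"
      using Fm_comp[OF l(1) f z(1)] l(2) Fm_comp[OF km pm(2) z(1)] z(2) w(2) by simp
    then have "Fm G l z = x"
      using Gf Fm_closed[OF l(1) z(1)] x(1) unfolding F_injective_def mor_Dom[OF f]
      by (blast dest: inj_onD)
    then show "x \<in> T X" using T_functorial[OF l(1), of z] triv[OF e ee k] z(1) by simp
  qed
  show "F_exact A S f g"
  proof (rule stable_exactI[OF f g gf])
    interpret Y: comm_group "Fo G Y" using Fo_comm_group[OF O(2)] .
    interpret g: group_hom "Fo G Y" "Fo G Z" "Fm G g" using Fm_group_hom[OF g] .
    fix y assume y: "y \<in> carrier (Fo G Y)" "Fm G g y \<in> T Z"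
    let ?V = "term_at (P Z) 0" and ?q = "aug (P Z)"
    have q: "is_precover A W ?V Z ?q" using proper_resolution_precover proper[OF O(3)] by auto
    note qm = is_precoverD[OF q]
    obtain w where w: "w \<in> carrier (Fo G ?V)" "Fm G g y = Fm G ?q w" using T_memE[OF O(3) y(2)] .
    \<comment> \<open>Since \<open>?V\<close> lies in \<open>W\<close>, its arrow to
      \<open>Z\<close> lifts along \<open>g\<close>. The element \<open>?t\<close> obtained from the
      lift lies in \<open>T Y\<close> and has the same image as \<open>y\<close>, so dividing by it
      moves \<open>y\<close> into the kernel of \<open>G\<close> on \<open>g\<close> without
      changing its class.\<close>
    obtain l where l: "l \<in> mor A ?V Y" "g \<cdot> l = ?q" using hom_exact_short_lift[OF he g qm] .
    let ?t = "Fm G l w"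
    have t: "?t \<in> carrier (Fo G Y)" "?t \<in> T Y"
      using Fm_closed[OF l(1) w(1)] T_memI[OF qm(1) l(1) w(1)] by auto
    have "Fm G g ?t = Fm G g y" using Fm_comp[OF l(1) g w(1)] l(2) w(2) by simp
    then have "Fm G g (y \<otimes>\<^bsub>Fo G Y\<^esub> inv\<^bsub>Fo G Y\<^esub> ?t) = \<one>\<^bsub>Fo G Z\<^esub>" using y t by simp
    then have "y \<otimes>\<^bsub>Fo G Y\<^esub> inv\<^bsub>Fo G Y\<^esub> ?t \<in> Fm G f ` carrier (Fo G X)"
      using Gfg y t unfolding F_exact_def mor_Dom[OF f] mor_Dom[OF g] mor_Cod[OF g] kernel_def
      by simp
    then obtain x where x: "x \<in> carrier (Fo G X)"
      "Fm G f x = y \<otimes>\<^bsub>Fo G Y\<^esub> inv\<^bsub>Fo G Y\<^esub> ?t" by auto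
    have "y \<otimes>\<^bsub>Fo G Y\<^esub> inv\<^bsub>Fo G Y\<^esub> Fm G f x = ?t"
      using x y t by (simp add: Y.inv_mult_group Y.m_comm Y.m_assoc[symmetric])
    then show "\<exists>x \<in> carrier (Fo G X). y \<otimes>\<^bsub>Fo G Y\<^esub> inv\<^bsub>Fo G Y\<^esub> Fm G f x \<in> T Y"
      using x(1) t(2) by metis
  qed
qed

end

text \<open>The families \<open>P\<close> and \<open>\<Omega>\<close> are arbitrary and chosen
  independently of each other, so the equivalence holds for every choice of resolutions and of
  syzygies.\<close>

theorem corollary2p13:
  fixes A :: "('o, 'm) cat"
    and W :: "'o set"
    and G :: "('o, 'm, 'g) ab_functor"
    and P :: "'o \<Rightarrow> ('o, 'm) resolution"
    and \<Omega> :: "nat \<Rightarrow> 'o \<Rightarrow> 'o"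
  assumes "abelian_category A"
    and "subcategory A W"
    and "special_precovering A W"
    and "additive_functor A G"
    and "left_hom_exact A W G"
    and "\<And>N. N \<in> Obj A \<Longrightarrow> proper_resolution A W N (P N)"
    and "\<And>N i. N \<in> Obj A \<Longrightarrow> i \<ge> 1 \<Longrightarrow> is_syzygy A W i N (\<Omega> i N)"
  shows "(left_hom_exact A W (stable_functor A P G) \<longleftrightarrow>
           (\<forall>N \<in> Obj A. \<forall>i \<ge> 1. trivial_group (Fo (stable_functor A P G) (\<Omega> i N)))) \<and>
         ((\<forall>N \<in> Obj A. \<forall>i \<ge> 1. trivial_group (Fo (stable_functor A P G) (\<Omega> i N))) \<longleftrightarrow>
           (\<forall>N \<in> Obj A. trivial_group (Fo (stable_functor A P G) (\<Omega> 1 N))))"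
    (is "(?i \<longleftrightarrow> ?ii) \<and> (?ii \<longleftrightarrow> ?iii)")
proof -
  interpret abelian_category A by fact
  interpret stable_functor_data A G W P
    using assms by unfold_locales (auto simp: subcategory_def)
  have syzygy: ?ii if S: ?i
  proof (intro ballI allI impI)
    fix N and i :: nat assume N: "N \<in> Obj A" and i: "i \<ge> 1"
    then obtain j where j: "i = Suc j" by (cases i) auto
    obtain Q c where Q: "proper_resolution A W N Q" and c: "is_cokernel A (diff Q (Suc j)) c"
      "Cod A c = \<Omega> i N"
      using assms(7)[OF N i] j by (auto simp: is_syzygy_def special_proper_resolution_def)
    obtain V M e m where e: "is_precover A W V M e" "is_epi A e"
      and m: "m \<in> mor A (Cod A c) V" "is_kernel A e m"
      using syzygy_precover[OF Q c(1)] .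
    show "trivial_group (Fo (stable_functor A P G) (\<Omega> i N))"
      using precover_kernel_trivial_of_left_exact[OF S e m(2)] mor_Dom[OF m(1)] c(2)
        stable_trivial_iff mor_Dom_Obj[OF m(1)] by simp
  qed
  have ?i if iii: ?iii
  proof (rule stable_left_exact[OF assms(5)])
    fix V N e k assume e: "is_precover A W V N e" and k: "is_kernel A e k"
    have N: "N \<in> Obj A" using is_precoverD(2)[OF e] mor_Cod_Obj by blast
    \<comment> \<open>The resolution \<open>Q\<close> behind the chosen syzygy may differ from
      \<open>P N\<close>, and its augmentation from \<open>e\<close>. Vanishing on the one kernel
      that it supplies passes to the kernel of \<open>e\<close> by
      \<open>kernel_of_precover_unique\<close>.\<close>
    obtain Q c where Q: "proper_resolution A W N Q" and c: "is_cokernel A (diff Q 1) c"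
      "Cod A c = \<Omega> 1 N"
      using assms(7)[OF N, of 1] by (auto simp: is_syzygy_def special_proper_resolution_def)
    obtain m where m: "m \<in> mor A (Cod A c) (term_at Q 0)" "is_kernel A (aug Q) m"
      using first_syzygy_kernel[OF Q c(1)] .
    have "T (Dom A m) = carrier (Fo G (Dom A m))"
      using bspec[OF iii N] c(2) mor_Dom[OF m(1)] mor_Dom_Obj[OF m(1)] stable_trivial_iff by simp
    then show "T (Dom A k) = carrier (Fo G (Dom A k))"
      using kernel_of_precover_unique[OF e k proper_resolution_precover[OF Q] m(2)] by blast
  qed
  \<comment> \<open>Statement (iii) is the case \<open>i = 1\<close> of (ii), which closes the
    cycle.\<close>
  then show ?thesis using syzygy by auto
qed

end
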